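(* Let $T:=[T_1,\ldots,T_n]\in B(\mathcal{H})^n$ be an $n$-tuple of operators with joint spectral radius $r(T_1,\ldots,T_n)<1$. Then, for any $f\in H^\infty(B(\mathcal{X})^n_1)$, $$f(T_1,\ldots,T_n)=\mathcal{C}_T(f(S_1,\ldots,S_n)),$$ where $f(T_1,\ldots,T_n)$ is defined by the free analytic functional calculus, and $f(S_1,\ldots,S_n)$ is the boundary function of $f$. Moreover, $$\|f(T_1,\ldots,T_n)\|\le\Big(\sum_{k=0}^\infty\Big\|\sum_{|\alpha|=k}T_\alpha T_\alpha^*\Big\|^{1/2}\Big)\|f\|_\infty.$$
   Context: $\mathbb{F}_n^+$ is the unital free semigroup on generators $g_1,\ldots,g_n$ with identity $g_0$; $|\alpha|$ is word length; $\tilde\alpha:=g_{i_k}\cdots g_{i_1}$ is the reverse of $\alpha=g_{i_1}\cdots g_{i_k}$; $T_\alpha:=T_{i_1}\cdots T_{i_k}$, $T_{g_0}:=I$. The joint spectral radius is $r(T_1,\ldots,T_n):=\lim_{k\to\infty}\|\sum_{|\alpha|=k}T_\alpha T_\alpha^*\|^{1/2k}$. $Hol(B(\mathcal{X})^n_1)$ is the set of formal power series $f=\sum_\alpha a_\alpha Z_\alpha$, $a_\alpha\in\mathbb{C}$, in noncommuting indeterminates with $\limsup_{k\to\infty}(\sum_{|\alpha|=k}|a_\alpha|^2)^{1/2k}\le1$; $f(X_1,\ldots,X_n):=\sum_{k=0}^\infty\sum_{|\alpha|=k}a_\alpha X_\alpha$ converges in norm whenever $\|\sum_iX_iX_i^*\|<1$.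 $H^\infty(B(\mathcal{X})^n_1)$ is the set of such $f$ with $\|f\|_\infty:=\sup\|f(X_1,\ldots,X_n)\|<\infty$, supremum over all Hilbert spaces and all $n$-tuples on them with $\|\sum_iX_iX_i^*\|<1$. Free analytic functional calculus: if $r(T_1,\ldots,T_n)<1$, $f(T_1,\ldots,T_n):=\sum_{k=0}^\infty\sum_{|\alpha|=k}a_\alpha T_\alpha$, the series converging in norm. $F^2(H_n)=\mathbb{C}1\oplus\bigoplus_{m\ge1}H_n^{\otimes m}$ is the full Fock space, $H_n$ an $n$-dimensional Hilbert space with orthonormal basis $e_1,\ldots,e_n$, $e_\alpha:=e_{i_1}\otimes\cdots\otimes e_{i_k}$, $e_{g_0}:=1$. $S_i\xi:=e_i\otimes\xi$ and $R_i\xi:=\xi\otimes e_i$ are the left and right creation operators. For $f\in H^\infty(B(\mathcal{X})^n_1)$ the boundary function $f(S_1,\ldots,S_n)\in B(F^2(H_n))$ is the (bounded) operator of left multiplication by $\sum_\alpha a_\alpha e_\alpha$, i.e. $e_\beta\mapsto\sum_\alpha a_\alpha e_{\alpha\beta}$. The Cauchy kernel is $C_T(R_1,\ldots,R_n):=\sum_{k=0}^\infty\sum_{|\alpha|=k}R_\alpha\otimes T_{\tilde\alpha}^*\in B(F^2(H_n)\otimes\mathcal{H})$ (norm convergent when $r(T_1,\ldots,T_n)<1$), and the Cauchy transform $\mathcal{C}_T:B(F^2(H_n))\to B(\mathcal{H})$ is defined by $\langle\mathcal{C}_T(A)x,y\rangle:=\langle(A\otimes I_{\mathcal{H}})(1\otimes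 x),C_T(R_1,\ldots,R_n)(1\otimes y)\rangle$ for $x,y\in\mathcal{H}$. *)

theory Defs
  imports
    "HOL-Analysis.Analysis"
    "HOL-Library.Infinite_Typeclass"
    "HOL-Algebra.Module"
begin

section \<open>Complex Hilbert spaces\<close>

text \<open>The inner product is linear in the first argument and conjugate linear in the second.
  The library's real inner product is its real part, so that the library's norm is the Hilbert
  space norm. Positive definiteness and completeness come from \<^class>\<open>real_inner\<close> and
  \<^class>\<open>banach\<close>.\<close>

class chilbert_space = real_inner + banach +
  fixes scaleC :: "complex \<Rightarrow> 'a \<Rightarrow> 'a"  (infixr \<open>*\<^sub>C\<close> 75)
    and cinner :: "'a \<Rightarrow> 'a \<Rightarrow> complex"
  assumes scaleC_add_right: "c *\<^sub>C (x + y) = c *\<^sub>C x + c *\<^sub>C y"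
    and scaleC_add_left: "(c + d) *\<^sub>C x = c *\<^sub>C x + d *\<^sub>C x"
    and scaleC_scaleC: "c *\<^sub>C d *\<^sub>C x = (c * d) *\<^sub>C x"
    and scaleR_scaleC: "r *\<^sub>R x = complex_of_real r *\<^sub>C x"
    and cinner_commute: "cinner x y = cnj (cinner y x)"
    and cinner_add_left: "cinner (x + y) z = cinner x z + cinner y z"
    and cinner_scaleC_left: "cinner (c *\<^sub>C x) y = c * cinner x y"
    and inner_eq_Re_cinner: "inner x y = Re (cinner x y)"

lemma scaleC_one: "1 *\<^sub>C x = (x :: 'a :: chilbert_space)"
  using scaleR_scaleC[of 1 x] by simp

lemma cinner_add_right: "cinner x (y + z) = cinner x y + cinner x (z :: 'a :: chilbert_space)"
  by (metis cinner_add_left cinner_commute complex_cnj_add)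

lemma cinner_scaleC_right: "cinner x (c *\<^sub>C y) = cnj c * cinner x (y :: 'a :: chilbert_space)"
  by (metis cinner_commute cinner_scaleC_left complex_cnj_mult)

lemma cinner_self: "cinner x x = complex_of_real ((norm (x :: 'a :: chilbert_space))\<^sup>2)"
proof -
  have "Im (cinner x x) = 0"
    using cinner_commute[of x x] by (metis cnj.simps(2) eq_neg_iff_add_eq_0 double_zero)
  moreover have "Re (cinner x x) = (norm x)\<^sup>2"
    by (simp add: power2_norm_eq_inner inner_eq_Re_cinner)
  ultimately show ?thesis by (simp add: complex_eq_iff)
qed

lemma norm_scaleC: "norm (c *\<^sub>C x) = cmod c * norm (x :: 'a :: chilbert_space)"
proof -
  have "complex_of_real ((norm (c *\<^sub>C x))\<^sup>2) = c * cnj c * complex_of_real ((norm x)\<^sup>2)"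
    by (simp only: cinner_self[symmetric] cinner_scaleC_left cinner_scaleC_right mult_ac)
  also have "\<dots> = complex_of_real ((cmod c * norm x)\<^sup>2)"
    using complex_norm_square[of c] by (simp add: power_mult_distrib)
  finally have "(norm (c *\<^sub>C x))\<^sup>2 = (cmod c * norm x)\<^sup>2"
    using of_real_eq_iff by blast
  then show ?thesis by (simp add: power2_eq_iff_nonneg)
qed

lemma norm_cinner_le: "cmod (cinner x y) \<le> norm x * norm (y :: 'a :: chilbert_space)"
proof -
  define z where "z = cinner x y"
  define c where "c = (if z = 0 then 1 else cnj z / cmod z)"
  have c: "cmod c = 1" "c * z = cmod z"
    using complex_norm_square[of z] by (auto simp: c_def norm_divide power2_eq_square field_simps)
  have "cmod z = Re (cinner (c *\<^sub>C x) y)"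
    using c(2) by (simp add: cinner_scaleC_left z_def[symmetric])
  also have "\<dots> \<le> norm (c *\<^sub>C x) * norm y"
    using Cauchy_Schwarz_ineq2[of "c *\<^sub>C x" y] by (simp add: inner_eq_Re_cinner)
  finally show ?thesis by (simp add: z_def norm_scaleC c(1))
qed

instantiation complex :: chilbert_space
begin

definition scaleC_complex :: "complex \<Rightarrow> complex \<Rightarrow> complex" where
  "scaleC_complex c z = c * z"

definition cinner_complex :: "complex \<Rightarrow> complex \<Rightarrow> complex" where
  "cinner_complex z w = z * cnj w"

instance
  by standard
    (auto simp: scaleC_complex_def cinner_complex_def inner_complex_def algebra_simps scaleR_conv_of_real)

end

definition clinear :: "('a :: chilbert_space \<Rightarrow> 'b :: chilbert_space) \<Rightarrow> bool" where
  "clinear F \<longleftrightarrow> (\<forall>x y. F (x + y) = F x + F y) \<and> (\<forall>c x. F (c *\<^sub>C x) = c *\<^sub>C F x)"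

text \<open>A bounded operator is an element of the library's type of bounded real-linear maps,
  with its operator norm, that is in addition \<^const>\<open>clinear\<close>.\<close>

lemma bounded_linear_scaleC: "bounded_linear (\<lambda>x. c *\<^sub>C (x :: 'a :: chilbert_space))"
  by (rule bounded_linear_intro[where K = "cmod c"])
    (auto simp: scaleC_add_right scaleR_scaleC scaleC_scaleC mult.commute norm_scaleC)

lift_definition scaleC_blinfun ::
    "complex \<Rightarrow> ('a :: chilbert_space \<Rightarrow>\<^sub>L 'b :: chilbert_space) \<Rightarrow> 'a \<Rightarrow>\<^sub>L 'b"
  is "\<lambda>c A x. c *\<^sub>C A x"
  by (rule bounded_linear_compose[OF bounded_linear_scaleC])

definition cadjoint :: "('a :: chilbert_space \<Rightarrow>\<^sub>L 'b :: chilbert_space) \<Rightarrow> 'b \<Rightarrow>\<^sub>L 'a" where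
  "cadjoint A = (THE B :: 'b \<Rightarrow>\<^sub>L 'a. clinear B \<and> (\<forall>x y. cinner (A x) y = cinner x (B y)))"


section \<open>The Hilbert spaces $\ell^2(I; H)$\<close>

typedef (overloaded) ('i, 'h :: chilbert_space) ell2 =
    "{v :: 'i \<Rightarrow> 'h. (\<lambda>i. (norm (v i))\<^sup>2) summable_on UNIV}"
  by (rule exI[of _ "\<lambda>_. 0"]) simp

setup_lifting type_definition_ell2

lemma ell2_add_summable:
  fixes v w :: "'i \<Rightarrow> 'h :: chilbert_space"
  assumes "(\<lambda>i. (norm (v i))\<^sup>2) summable_on UNIV" "(\<lambda>i. (norm (w i))\<^sup>2) summable_on UNIV"
  shows "(\<lambda>i. (norm (v i + w i))\<^sup>2) summable_on UNIV"
proof (rule summable_on_comparison_test)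
  show "(\<lambda>i. 2 * (norm (v i))\<^sup>2 + 2 * (norm (w i))\<^sup>2) summable_on UNIV"
    by (intro summable_on_add summable_on_cmult_right assms)
  fix i
  have "(norm (v i + w i))\<^sup>2 \<le> (norm (v i) + norm (w i))\<^sup>2"
    by (intro power_mono norm_triangle_ineq) auto
  also have "\<dots> \<le> 2 * (norm (v i))\<^sup>2 + 2 * (norm (w i))\<^sup>2"
    using sum_squares_bound[of "norm (v i)" "norm (w i)"] by (simp add: power2_sum)
  finally show "(norm (v i + w i))\<^sup>2 \<le> 2 * (norm (v i))\<^sup>2 + 2 * (norm (w i))\<^sup>2" .
qed auto

lemma ell2_scaleC_summable:
  fixes v :: "'i \<Rightarrow> 'h :: chilbert_space"
  assumes "(\<lambda>i. (norm (v i))\<^sup>2) summable_on UNIV"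
  shows "(\<lambda>i. (norm (c *\<^sub>C v i))\<^sup>2) summable_on UNIV"
  using summable_on_cmult_right[OF assms, of "(cmod c)\<^sup>2"]
  by (simp add: norm_scaleC power_mult_distrib)

lemma ell2_cinner_summable:
  fixes v w :: "'i \<Rightarrow> 'h :: chilbert_space"
  assumes "(\<lambda>i. (norm (v i))\<^sup>2) summable_on UNIV" "(\<lambda>i. (norm (w i))\<^sup>2) summable_on UNIV"
  shows "(\<lambda>i. cinner (v i) (w i)) summable_on UNIV"
proof (rule abs_summable_summable, rule summable_on_comparison_test)
  show "(\<lambda>i. (norm (v i))\<^sup>2 + (norm (w i))\<^sup>2) summable_on UNIV"
    by (intro summable_on_add assms)
  fix i
  have "cmod (cinner (v i) (w i)) \<le> norm (v i) * norm (w i)" by (rule norm_cinner_le)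
  also have "\<dots> \<le> 2 * (norm (v i) * norm (w i))" by simp
  also have "\<dots> \<le> (norm (v i))\<^sup>2 + (norm (w i))\<^sup>2"
    using sum_squares_bound[of "norm (v i)" "norm (w i)"] by simp
  finally show "cmod (cinner (v i) (w i)) \<le> (norm (v i))\<^sup>2 + (norm (w i))\<^sup>2" .
qed auto

lemma Rep_ell2_summable: "(\<lambda>i. (norm (Rep_ell2 x i))\<^sup>2) summable_on UNIV"
  using Rep_ell2[of x] by simp

lemma ell2_inner_summable:
  fixes v w :: "'i \<Rightarrow> 'h :: chilbert_space"
  assumes "(\<lambda>i. (norm (v i))\<^sup>2) summable_on UNIV" "(\<lambda>i. (norm (w i))\<^sup>2) summable_on UNIV"
  shows "(\<lambda>i. inner (v i) (w i)) summable_on UNIV"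
  using summable_on_Re[OF ell2_cinner_summable[OF assms]] by (simp add: inner_eq_Re_cinner)

instantiation ell2 :: (type, chilbert_space) real_inner
begin

lift_definition zero_ell2 :: "('a, 'b) ell2" is "\<lambda>_. 0" by simp

lift_definition plus_ell2 :: "('a, 'b) ell2 \<Rightarrow> ('a, 'b) ell2 \<Rightarrow> ('a, 'b) ell2"
  is "\<lambda>v w i. v i + w i" by (rule ell2_add_summable)

lift_definition uminus_ell2 :: "('a, 'b) ell2 \<Rightarrow> ('a, 'b) ell2" is "\<lambda>v i. - v i" by simp

lift_definition minus_ell2 :: "('a, 'b) ell2 \<Rightarrow> ('a, 'b) ell2 \<Rightarrow> ('a, 'b) ell2"
  is "\<lambda>v w i. v i - w i"
proof -
  fix v w :: "'a \<Rightarrow> 'b"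
  assume "(\<lambda>i. (norm (v i))\<^sup>2) summable_on UNIV" "(\<lambda>i. (norm (w i))\<^sup>2) summable_on UNIV"
  then show "(\<lambda>i. (norm (v i - w i))\<^sup>2) summable_on UNIV"
    using ell2_add_summable[of v "\<lambda>i. - w i"] by simp
qed

lift_definition scaleR_ell2 :: "real \<Rightarrow> ('a, 'b) ell2 \<Rightarrow> ('a, 'b) ell2"
  is "\<lambda>r v i. r *\<^sub>R v i"
  using ell2_scaleC_summable by (simp add: scaleR_scaleC)

lift_definition inner_ell2 :: "('a, 'b) ell2 \<Rightarrow> ('a, 'b) ell2 \<Rightarrow> real"
  is "\<lambda>v w. \<Sum>\<^sub>\<infinity>i. inner (v i) (w i)" .

definition norm_ell2 :: "('a, 'b) ell2 \<Rightarrow> real" where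
  "norm_ell2 x = sqrt (inner x x)"

definition dist_ell2 :: "('a, 'b) ell2 \<Rightarrow> ('a, 'b) ell2 \<Rightarrow> real" where
  "dist_ell2 x y = norm (x - y)"

definition sgn_ell2 :: "('a, 'b) ell2 \<Rightarrow> ('a, 'b) ell2" where
  "sgn_ell2 x = inverse (norm x) *\<^sub>R x"

definition uniformity_ell2 :: "(('a, 'b) ell2 \<times> ('a, 'b) ell2) filter" where
  "uniformity_ell2 = (INF e\<in>{0 <..}. principal {(x, y). dist x y < e})"

definition open_ell2 :: "('a, 'b) ell2 set \<Rightarrow> bool" where
  "open_ell2 U \<longleftrightarrow> (\<forall>x\<in>U. \<forall>\<^sub>F (x', y) in uniformity. x' = x \<longrightarrow> y \<in> U)"

instance
proof
  fix x y z :: "('a, 'b) ell2" and r s :: real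
  show "x + y + z = x + (y + z)" by transfer (simp add: add.assoc)
  show "x + y = y + x" by transfer (simp add: add.commute)
  show "0 + x = x" by transfer simp
  show "- x + x = 0" by transfer simp
  show "x - y = x + - y" by transfer simp
  show "r *\<^sub>R (x + y) = r *\<^sub>R x + r *\<^sub>R y" by transfer (simp add: scaleR_add_right)
  show "(r + s) *\<^sub>R x = r *\<^sub>R x + s *\<^sub>R x" by transfer (simp add: scaleR_add_left)
  show "r *\<^sub>R s *\<^sub>R x = (r * s) *\<^sub>R x" by transfer simp
  show "1 *\<^sub>R x = x" by transfer simp
  show "dist x y = norm (x - y)" by (rule dist_ell2_def)
  show "sgn x = inverse (norm x) *\<^sub>R x" by (rule sgn_ell2_def)
  show "uniformity = (INF e\<in>{0 <..}. principal {(x :: ('a, 'b) ell2, y). dist x y < e})"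
    by (rule uniformity_ell2_def)
  show "open U \<longleftrightarrow> (\<forall>x\<in>U. \<forall>\<^sub>F (x', y) in uniformity. x' = x \<longrightarrow> y \<in> U)"
    for U :: "('a, 'b) ell2 set"
    by (rule open_ell2_def)
  show "inner x y = inner y x" by transfer (simp add: inner_commute)
  show "inner (x + y) z = inner x z + inner y z"
    by transfer (simp add: inner_add_left infsum_add ell2_inner_summable)
  show "inner (r *\<^sub>R x) y = r * inner x y" by transfer (simp add: infsum_cmult_right')
  show "0 \<le> inner x x" by transfer (simp add: infsum_nonneg)
  show "inner x x = 0 \<longleftrightarrow> x = 0"
  proof transfer
    fix v :: "'a \<Rightarrow> 'b"
    assume v: "(\<lambda>i. (norm (v i))\<^sup>2) summable_on UNIV"
    have "v = (\<lambda>_. 0)" if "(\<Sum>\<^sub>\<infinity>i. inner (v i) (v i)) = 0"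
    proof
      fix i
      have "inner (v i) (v i) = 0"
        by (rule nonneg_infsum_le_0D[where A = UNIV and f = "\<lambda>i. inner (v i) (v i)"])
          (use that ell2_inner_summable[OF v v] in auto)
      then show "v i = 0" by simp
    qed
    then show "(\<Sum>\<^sub>\<infinity>i. inner (v i) (v i)) = 0 \<longleftrightarrow> v = (\<lambda>_. 0)" by auto
  qed
  show "norm x = sqrt (inner x x)" by (rule norm_ell2_def)
qed

end

lemma ell2_norm_sq: "(norm x)\<^sup>2 = (\<Sum>\<^sub>\<infinity>i. (norm (Rep_ell2 x i))\<^sup>2)"
  by (simp add: power2_norm_eq_inner inner_ell2.rep_eq)

lemma ell2_sum_le_norm_sq: "finite F \<Longrightarrow> (\<Sum>i\<in>F. (norm (Rep_ell2 x i))\<^sup>2) \<le> (norm x)\<^sup>2"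
  unfolding ell2_norm_sq by (rule finite_sum_le_infsum) (auto simp: Rep_ell2_summable)

lemma ell2_norm_coord_le: "norm (Rep_ell2 x i) \<le> norm x"
  using ell2_sum_le_norm_sq[of "{i}" x] by (simp add: power2_le_iff_abs_le)

instance ell2 :: (type, chilbert_space) banach
proof
  fix X :: "nat \<Rightarrow> ('a, 'b) ell2"
  assume X: "Cauchy X"
  have "Cauchy (\<lambda>n. Rep_ell2 (X n) i)" for i
  proof (rule metric_CauchyI)
    fix e :: real
    assume "e > 0"
    then obtain N where N: "\<And>m n. m \<ge> N \<Longrightarrow> n \<ge> N \<Longrightarrow> dist (X m) (X n) < e"
      using metric_CauchyD[OF X] by blast
    have "dist (Rep_ell2 (X m) i) (Rep_ell2 (X n) i) \<le> dist (X m) (X n)" for m n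
      using ell2_norm_coord_le[of "X m - X n" i] by (simp add: dist_norm minus_ell2.rep_eq)
    then show "\<exists>M. \<forall>m\<ge>M. \<forall>n\<ge>M. dist (Rep_ell2 (X m) i) (Rep_ell2 (X n) i) < e"
      using N by (meson le_less_trans)
  qed
  then have "\<exists>l. (\<lambda>n. Rep_ell2 (X n) i) \<longlonglongrightarrow> l" for i
    by (simp add: Cauchy_convergent convergent_def[symmetric])
  then obtain l where l: "\<And>i. (\<lambda>n. Rep_ell2 (X n) i) \<longlonglongrightarrow> l i" by metis
  have bound: "(\<Sum>i\<in>F. (norm (Rep_ell2 (X m) i - l i))\<^sup>2) \<le> e\<^sup>2"
    if N: "\<And>m n. m \<ge> N \<Longrightarrow> n \<ge> N \<Longrightarrow> dist (X m) (X n) < e" and m: "m \<ge> N" and F: "finite F"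
    for N e m F
  proof (rule tendsto_upperbound)
    show "(\<lambda>n. \<Sum>i\<in>F. (norm (Rep_ell2 (X m) i - Rep_ell2 (X n) i))\<^sup>2)
      \<longlonglongrightarrow> (\<Sum>i\<in>F. (norm (Rep_ell2 (X m) i - l i))\<^sup>2)"
      by (intro tendsto_sum tendsto_power tendsto_norm tendsto_diff tendsto_const l)
    show "\<forall>\<^sub>F n in sequentially. (\<Sum>i\<in>F. (norm (Rep_ell2 (X m) i - Rep_ell2 (X n) i))\<^sup>2) \<le> e\<^sup>2"
      using eventually_ge_at_top[of N]
    proof eventually_elim
      case (elim n)
      have "(\<Sum>i\<in>F. (norm (Rep_ell2 (X m) i - Rep_ell2 (X n) i))\<^sup>2) \<le> (norm (X m - X n))\<^sup>2"
        using ell2_sum_le_norm_sq[OF F, of "X m - X n"] by (simp add: minus_ell2.rep_eq)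
      also have "\<dots> \<le> e\<^sup>2"
        using N[OF m elim] by (intro power_mono) (auto simp: dist_norm)
      finally show ?case .
    qed
  qed auto
  have diff: "(\<lambda>i. (norm (Rep_ell2 (X m) i - l i))\<^sup>2) summable_on UNIV"
    if "\<And>m n. m \<ge> N \<Longrightarrow> n \<ge> N \<Longrightarrow> dist (X m) (X n) < e" "m \<ge> N" for N e m
    by (rule nonneg_bdd_above_summable_on) (auto intro!: bdd_aboveI2[where M = "e\<^sup>2"] bound[OF that])
  obtain N1 where N1: "\<And>m n. m \<ge> N1 \<Longrightarrow> n \<ge> N1 \<Longrightarrow> dist (X m) (X n) < 1"
    using metric_CauchyD[OF X, of 1] by auto
  have "(\<lambda>i. (norm (l i - Rep_ell2 (X N1) i))\<^sup>2) summable_on UNIV"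
    using diff[OF N1, of N1] by (simp add: norm_minus_commute)
  from ell2_add_summable[OF Rep_ell2_summable[of "X N1"] this]
  have "(\<lambda>i. (norm (l i))\<^sup>2) summable_on UNIV" by simp
  then have L: "Rep_ell2 (Abs_ell2 l) = l" by (simp add: Abs_ell2_inverse)
  have "X \<longlonglongrightarrow> Abs_ell2 l"
  proof (rule metric_LIMSEQ_I)
    fix e :: real
    assume e: "e > 0"
    then obtain N where N: "\<And>m n. m \<ge> N \<Longrightarrow> n \<ge> N \<Longrightarrow> dist (X m) (X n) < e / 2"
      using metric_CauchyD[OF X, of "e / 2"] by auto
    have "dist (X m) (Abs_ell2 l) < e" if m: "m \<ge> N" for m
    proof -
      have "(norm (X m - Abs_ell2 l))\<^sup>2 \<le> (e / 2)\<^sup>2"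
        unfolding ell2_norm_sq minus_ell2.rep_eq L
        by (rule infsum_le_finite_sums[OF diff[OF N m]]) (auto intro: bound[OF N m])
      then have "norm (X m - Abs_ell2 l) \<le> e / 2"
        using e by (simp add: power2_le_iff_abs_le)
      then show ?thesis using e by (simp add: dist_norm)
    qed
    then show "\<exists>no. \<forall>n\<ge>no. dist (X n) (Abs_ell2 l) < e" by blast
  qed
  then show "convergent X" by (auto simp: convergent_def)
qed

instantiation ell2 :: (type, chilbert_space) chilbert_space
begin

lift_definition scaleC_ell2 :: "complex \<Rightarrow> ('a, 'b) ell2 \<Rightarrow> ('a, 'b) ell2"
  is "\<lambda>c v i. c *\<^sub>C v i" by (rule ell2_scaleC_summable)

lift_definition cinner_ell2 :: "('a, 'b) ell2 \<Rightarrow> ('a, 'b) ell2 \<Rightarrow> complex"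
  is "\<lambda>v w. \<Sum>\<^sub>\<infinity>i. cinner (v i) (w i)" .

instance
proof
  fix x y z :: "('a, 'b) ell2" and c d :: complex and r :: real
  show "c *\<^sub>C (x + y) = c *\<^sub>C x + c *\<^sub>C y" by transfer (simp add: scaleC_add_right)
  show "(c + d) *\<^sub>C x = c *\<^sub>C x + d *\<^sub>C x" by transfer (simp add: scaleC_add_left)
  show "c *\<^sub>C d *\<^sub>C x = (c * d) *\<^sub>C x" by transfer (simp add: scaleC_scaleC)
  show "r *\<^sub>R x = complex_of_real r *\<^sub>C x" by transfer (simp add: scaleR_scaleC)
  show "cinner x y = cnj (cinner y x)"
    by transfer (simp add: infsum_cnj[symmetric] cinner_commute[symmetric] del: infsum_cnj)
  show "cinner (x + y) z = cinner x z + cinner y z"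
    by transfer (simp add: cinner_add_left infsum_add ell2_cinner_summable)
  show "cinner (c *\<^sub>C x) y = c * cinner x y"
    by transfer (simp add: cinner_scaleC_left infsum_cmult_right')
  show "inner x y = Re (cinner x y)"
    by transfer (simp add: inner_eq_Re_cinner infsum_Re ell2_cinner_summable)
qed

end


section \<open>The full Fock space and Hilbert tensor products with it\<close>

text \<open>The free semigroup on the generators $g_i$, $i$ ranging over the finite type \<open>'n\<close>, is
  \<open>'n list\<close> with concatenation; the empty word is the identity, and reversal is \<^const>\<open>rev\<close>.
  In the orthonormal basis $e_\alpha$ indexed by the words, the full Fock space is $\ell^2$ over
  the words, and its Hilbert tensor product with $H$ is $\ell^2$ over the words with values in
  $H$, where $(\xi \otimes x)(\alpha) = \xi(\alpha) x$.\<close>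

type_synonym 'n fock = "('n list, complex) ell2"

lift_definition fock_basis :: "'n list \<Rightarrow> 'n fock" is "\<lambda>\<alpha> \<beta>. if \<beta> = \<alpha> then 1 else 0"
proof -
  fix \<alpha> :: "'n list"
  have "(\<lambda>\<beta>. (cmod (if \<beta> = \<alpha> then 1 else 0))\<^sup>2) summable_on {\<alpha>}" by simp
  then show "(\<lambda>\<beta>. (cmod (if \<beta> = \<alpha> then 1 else 0))\<^sup>2) summable_on UNIV"
    by (subst summable_on_cong_neutral[where T = "{\<alpha>}"]) auto
qed

lift_definition tensor :: "('i, complex) ell2 \<Rightarrow> 'h :: chilbert_space \<Rightarrow> ('i, 'h) ell2"
  is "\<lambda>\<xi> x i. \<xi> i *\<^sub>C x"
  using summable_on_cmult_left by (force simp: norm_scaleC power_mult_distrib)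

lemma cinner_tensor:
  "cinner (tensor \<xi> x) (tensor \<eta> y) = cinner \<xi> \<eta> * cinner x y"
  by transfer
    (simp add: cinner_scaleC_left cinner_scaleC_right cinner_complex_def mult.assoc[symmetric]
      infsum_cmult_left', simp add: mult.commute)

definition tensor_op ::
    "(('i, complex) ell2 \<Rightarrow>\<^sub>L ('i, complex) ell2) \<Rightarrow> ('h :: chilbert_space \<Rightarrow>\<^sub>L 'h)
      \<Rightarrow> ('i, 'h) ell2 \<Rightarrow>\<^sub>L ('i, 'h) ell2" where
  "tensor_op A B = (THE C :: ('i, 'h) ell2 \<Rightarrow>\<^sub>L ('i, 'h) ell2. clinear C \<and> (\<forall>\<xi> x. C (tensor \<xi> x) = tensor (A \<xi>) (B x)))"

text \<open>Right creation $R_i \xi = \xi \otimes e_i$ maps $e_\beta$ to $e_{\beta g_i}$, so the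
  coefficient of $R_i \xi$ at $\gamma$ is that of $\xi$ at $\beta$ if $\gamma = \beta g_i$, and
  zero if $\gamma$ does not end in $g_i$.\<close>

definition right_shift :: "'n \<Rightarrow> ('n list \<Rightarrow> complex) \<Rightarrow> 'n list \<Rightarrow> complex" where
  "right_shift i \<xi> \<gamma> = (if \<gamma> \<noteq> [] \<and> last \<gamma> = i then \<xi> (butlast \<gamma>) else 0)"

lemma right_shift_has_sum:
  assumes "((\<lambda>\<beta>. (cmod (\<xi> \<beta>))\<^sup>2) has_sum s) UNIV"
  shows "((\<lambda>\<gamma>. (cmod (right_shift i \<xi> \<gamma>))\<^sup>2) has_sum s) UNIV"
proof -
  have inj: "inj (\<lambda>\<beta>. \<beta> @ [i])" by (rule injI) simp
  have "((\<lambda>\<gamma>. (cmod (right_shift i \<xi> \<gamma>))\<^sup>2) has_sum s) (range (\<lambda>\<beta>. \<beta> @ [i]))"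
    using assms by (subst has_sum_reindex[OF inj]) (simp add: o_def right_shift_def)
  moreover have "\<gamma> \<in> range (\<lambda>\<beta>. \<beta> @ [i])" if "\<gamma> \<noteq> []" "last \<gamma> = i" for \<gamma>
    using that by (metis append_butlast_last_id rangeI)
  ultimately show ?thesis
    by (subst has_sum_cong_neutral[where T = "range (\<lambda>\<beta>. \<beta> @ [i])"]) (auto simp: right_shift_def)
qed

lift_definition right_creation_vec :: "'n \<Rightarrow> 'n fock \<Rightarrow> 'n fock" is right_shift
  using right_shift_has_sum by (fastforce simp: summable_on_def)

lift_definition right_creation :: "'n \<Rightarrow> 'n fock \<Rightarrow>\<^sub>L 'n fock" is right_creation_vec
proof -
  fix i :: 'n
  have "(norm (right_creation_vec i \<xi>))\<^sup>2 = (norm \<xi>)\<^sup>2" for \<xi>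
    unfolding ell2_norm_sq right_creation_vec.rep_eq
    using has_sum_infsum[OF Rep_ell2_summable] by (intro infsumI right_shift_has_sum)
  then have "norm (right_creation_vec i \<xi>) \<le> norm \<xi> * 1" for \<xi>
    by (simp add: power2_eq_iff_nonneg)
  moreover have "right_creation_vec i (\<xi> + \<eta>) = right_creation_vec i \<xi> + right_creation_vec i \<eta>"
    for \<xi> \<eta>
    by transfer (auto simp: right_shift_def fun_eq_iff)
  moreover have "right_creation_vec i (r *\<^sub>R \<xi>) = r *\<^sub>R right_creation_vec i \<xi>" for r \<xi>
    by transfer (auto simp: right_shift_def fun_eq_iff)
  ultimately show "bounded_linear (right_creation_vec i)"
    by (intro bounded_linear_intro)
qed

lemma right_creation_fock_basis: "right_creation i (fock_basis \<beta>) = fock_basis (\<beta> @ [i])"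
proof -
  have "right_shift i (\<lambda>\<gamma>. if \<gamma> = \<beta> then 1 else 0) \<delta> = (if \<delta> = \<beta> @ [i] then 1 else 0)" for \<delta>
    by (cases \<delta> rule: rev_cases) (auto simp: right_shift_def)
  then show ?thesis
    unfolding right_creation.rep_eq by transfer blast
qed


section \<open>Free analytic functional calculus and Cauchy transform\<close>

fun word_op :: "('n \<Rightarrow> 'h :: chilbert_space \<Rightarrow>\<^sub>L 'h) \<Rightarrow> 'n list \<Rightarrow> 'h \<Rightarrow>\<^sub>L 'h" where
  "word_op T [] = id_blinfun"
| "word_op T (i # \<alpha>) = T i o\<^sub>L word_op T \<alpha>"

definition words :: "nat \<Rightarrow> 'n list set" where
  "words k = {\<alpha>. length \<alpha> = k}"

definition joint_spectral_radius :: "('n :: finite \<Rightarrow> 'h :: chilbert_space \<Rightarrow>\<^sub>L 'h) \<Rightarrow> real" where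
  "joint_spectral_radius T =
    lim (\<lambda>k. root (2 * k) (norm (\<Sum>\<alpha>\<in>words k. word_op T \<alpha> o\<^sub>L cadjoint (word_op T \<alpha>))))"

text \<open>The formal power series $\sum_\alpha a_\alpha Z_\alpha$ is given by its coefficients \<open>a\<close>.\<close>

definition free_hol :: "('n :: finite list \<Rightarrow> complex) set" where
  "free_hol = {a. limsup (\<lambda>k. ereal (root (2 * k) (\<Sum>\<alpha>\<in>words k. (cmod (a \<alpha>))\<^sup>2))) \<le> 1}"

definition free_eval ::
    "('n :: finite list \<Rightarrow> complex) \<Rightarrow> ('n \<Rightarrow> 'h :: chilbert_space \<Rightarrow>\<^sub>L 'h) \<Rightarrow> 'h \<Rightarrow>\<^sub>L 'h" where
  "free_eval a T = (\<Sum>k. \<Sum>\<alpha>\<in>words k. scaleC_blinfun (a \<alpha>) (word_op T \<alpha>))"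

definition boundary_function :: "('n :: finite list \<Rightarrow> complex) \<Rightarrow> 'n fock \<Rightarrow>\<^sub>L 'n fock" where
  "boundary_function a =
    (THE F :: 'n fock \<Rightarrow>\<^sub>L 'n fock. clinear F \<and>
      (\<forall>\<beta>. ((\<lambda>\<alpha>. a \<alpha> *\<^sub>C fock_basis (\<alpha> @ \<beta>)) has_sum F (fock_basis \<beta>)) UNIV))"

definition cauchy_kernel ::
    "('n :: finite \<Rightarrow> 'h :: chilbert_space \<Rightarrow>\<^sub>L 'h) \<Rightarrow> ('n list, 'h) ell2 \<Rightarrow>\<^sub>L ('n list, 'h) ell2" where
  "cauchy_kernel T =
    (\<Sum>k. \<Sum>\<alpha>\<in>words k. tensor_op (word_op right_creation \<alpha>) (cadjoint (word_op T (rev \<alpha>))))"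

definition cauchy_transform ::
    "('n :: finite \<Rightarrow> 'h :: chilbert_space \<Rightarrow>\<^sub>L 'h) \<Rightarrow> ('n fock \<Rightarrow>\<^sub>L 'n fock) \<Rightarrow> 'h \<Rightarrow>\<^sub>L 'h" where
  "cauchy_transform T A =
    (THE B :: 'h \<Rightarrow>\<^sub>L 'h. clinear B \<and>
      (\<forall>x y. cinner (B x) y =
        cinner (tensor_op A id_blinfun (tensor (fock_basis []) x))
          (cauchy_kernel T (tensor (fock_basis []) y))))"


section \<open>The norm of $H^\infty$\<close>

text \<open>The norm of $H^\infty$ is a supremum over all Hilbert spaces. As HOL cannot quantify over
  types inside a term, Hilbert spaces are represented here by structures: a carrier set in some
  type \<open>'v\<close> with arbitrary operations and inner product. The supremum is taken over all Hilbert
  spaces whose carrier is a subset of \<open>'v\<close>, so \<open>'v\<close> has to be large. A suitable choice is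
  \<open>'u \<Rightarrow> complex\<close> for an infinite type \<open>'u\<close>: it contains a copy of every Hilbert space with an
  orthonormal basis of cardinality at most that of \<open>'u\<close>, so as \<open>'u\<close> varies all Hilbert spaces
  are covered.\<close>

definition complex_ring :: "complex ring" where
  "complex_ring = \<lparr>carrier = UNIV, monoid.mult = (*), one = 1, ring.zero = 0, add = (+)\<rparr>"

record 'v inner_product_structure = "(complex, 'v) module" +
  ip :: "'v \<Rightarrow> 'v \<Rightarrow> complex"

definition ip_norm :: "('v, 'm) inner_product_structure_scheme \<Rightarrow> 'v \<Rightarrow> real" where
  "ip_norm K x = sqrt (Re (ip K x x))"

locale hilbert_structure = Module.module complex_ring K for K (structure) +
  assumes ip_add: "x \<in> carrier K \<Longrightarrow> y \<in> carrier K \<Longrightarrow> z \<in> carrier K \<Longrightarrow>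
      ip K (x \<oplus>\<^bsub>K\<^esub> y) z = ip K x z + ip K y z"
    and ip_smult: "x \<in> carrier K \<Longrightarrow> y \<in> carrier K \<Longrightarrow> ip K (c \<odot>\<^bsub>K\<^esub> x) y = c * ip K x y"
    and ip_commute: "x \<in> carrier K \<Longrightarrow> y \<in> carrier K \<Longrightarrow> ip K x y = cnj (ip K y x)"
    and ip_pos: "x \<in> carrier K \<Longrightarrow> x \<noteq> \<zero>\<^bsub>K\<^esub> \<Longrightarrow> Re (ip K x x) > 0"
    and ip_complete:
      "range s \<subseteq> carrier K \<Longrightarrow>
        (\<And>e. e > 0 \<Longrightarrow> \<exists>N. \<forall>m\<ge>N. \<forall>k\<ge>N. ip_norm K (s m \<ominus>\<^bsub>K\<^esub> s k) < e) \<Longrightarrow>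
        \<exists>l\<in>carrier K. (\<lambda>m. ip_norm K (s m \<ominus>\<^bsub>K\<^esub> l)) \<longlonglongrightarrow> 0"

text \<open>Operators on a structure are functions on \<open>'v\<close> of which only the values on the carrier
  matter.\<close>

definition struct_ops :: "'v inner_product_structure \<Rightarrow> ('v \<Rightarrow> 'v) set" where
  "struct_ops K = {A. A \<in> carrier K \<rightarrow> carrier K \<and>
    (\<forall>x\<in>carrier K. \<forall>y\<in>carrier K. A (x \<oplus>\<^bsub>K\<^esub> y) = A x \<oplus>\<^bsub>K\<^esub> A y) \<and>
    (\<forall>c. \<forall>x\<in>carrier K. A (c \<odot>\<^bsub>K\<^esub> x) = c \<odot>\<^bsub>K\<^esub> A x) \<and>
    (\<exists>M. \<forall>x\<in>carrier K. ip_norm K (A x) \<le> M * ip_norm K x)}"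

definition struct_opnorm :: "'v inner_product_structure \<Rightarrow> ('v \<Rightarrow> 'v) \<Rightarrow> real" where
  "struct_opnorm K A = Sup {ip_norm K (A x) |x. x \<in> carrier K \<and> ip_norm K x \<le> 1}"

definition struct_adjoint :: "'v inner_product_structure \<Rightarrow> ('v \<Rightarrow> 'v) \<Rightarrow> 'v \<Rightarrow> 'v" where
  "struct_adjoint K A =
    (SOME B. B \<in> struct_ops K \<and> (\<forall>x\<in>carrier K. \<forall>y\<in>carrier K. ip K (A x) y = ip K x (B y)))"

fun struct_word :: "('n \<Rightarrow> 'v \<Rightarrow> 'v) \<Rightarrow> 'n list \<Rightarrow> 'v \<Rightarrow> 'v" where
  "struct_word X [] = id"
| "struct_word X (i # \<alpha>) = X i \<circ> struct_word X \<alpha>"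

definition strict_row_contraction ::
    "'v inner_product_structure \<Rightarrow> ('n :: finite \<Rightarrow> 'v \<Rightarrow> 'v) \<Rightarrow> bool" where
  "strict_row_contraction K X \<longleftrightarrow> (\<forall>i. X i \<in> struct_ops K) \<and>
    struct_opnorm K (\<lambda>x. finsum K (\<lambda>i. X i (struct_adjoint K (X i) x)) UNIV) < 1"

text \<open>\<open>struct_eval a K X F\<close> states that the series $\sum_k \sum_{|\alpha|=k} a_\alpha X_\alpha$
  converges to \<open>F\<close> in operator norm.\<close>

definition struct_eval ::
    "('n :: finite list \<Rightarrow> complex) \<Rightarrow> 'v inner_product_structure \<Rightarrow> ('n \<Rightarrow> 'v \<Rightarrow> 'v) \<Rightarrow>
      ('v \<Rightarrow> 'v) \<Rightarrow> bool" where
  "struct_eval a K X F \<longleftrightarrow> F \<in> struct_ops K \<and>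
    (\<lambda>N. struct_opnorm K (\<lambda>x.
      finsum K (\<lambda>k. finsum K (\<lambda>\<alpha>. a \<alpha> \<odot>\<^bsub>K\<^esub> struct_word X \<alpha> x) (words k)) {..<N}
        \<ominus>\<^bsub>K\<^esub> F x)) \<longlonglongrightarrow> 0"

definition hinf_values :: "'v itself \<Rightarrow> ('n :: finite list \<Rightarrow> complex) \<Rightarrow> real set" where
  "hinf_values _ a = {struct_opnorm K F |(K :: 'v inner_product_structure) X F.
    hilbert_structure K \<and> strict_row_contraction K X \<and> struct_eval a K X F}"

definition hinf :: "'v itself \<Rightarrow> ('n :: finite list \<Rightarrow> complex) set" where
  "hinf U = {a \<in> free_hol. bdd_above (hinf_values U a)}"

definition hinf_norm :: "'v itself \<Rightarrow> ('n :: finite list \<Rightarrow> complex) \<Rightarrow> real" where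
  "hinf_norm U a = Sup (hinf_values U a)"

end

theory Submission
  imports Defs
begin

text \<open>A tuple $T$ with joint spectral radius less than one has summable row norms
  $c_k = \|\sum_{|\alpha|=k} T_\alpha T_\alpha^*\|^{1/2}$, since $c$ is submultiplicative (Fekete). As
  $C_T(R)(1 \otimes y) = \sum_\alpha e_\alpha \otimes T_\alpha^* y$ and
  $f(S) 1 = \sum_\alpha a_\alpha e_\alpha$, the two sides of the identity agree term by term. The
  norm bound follows from
  $\|\sum_{|\alpha|=k} a_\alpha T_\alpha\| \le (\sum_{|\alpha|=k} |a_\alpha|^2)^{1/2} c_k
    \le \|f\|_\infty c_k$. The second inequality, and the existence of $f(S)$ as a bounded
  operator, come from evaluating $f$ at the strict row contractions $rS$ on a copy of the Fock
  space inside the carrier type and letting $r \to 1$.\<close>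

section \<open>Bounded operators on complex Hilbert spaces\<close>

text \<open>The obstacle: the supremum in \<open>hinf_norm\<close> ranges over Hilbert spaces inside
  \<open>'u => complex\<close>, while the space on which T acts need not embed there, and r(T) < 1
  does not make T a row contraction. So f is never tested on T itself. It is tested only on Fock
  space, whose countable basis of words fits into any infinite \<open>'u\<close>, and what this says
  about the coefficients is then applied to T. The factor r < 1 is forced because S itself has row
  norm 1. A second burden is that adjoints, tensor products of operators, the boundary function and
  the Cauchy transform are definite descriptions, which say nothing until existence and uniqueness
  are proved. Hence the Riesz theorem and the bounded tensor product over Fock space.\<close>

lemma scaleC_zero_left [simp]: "0 *\<^sub>C (x :: 'a :: chilbert_space) = 0"
  using scaleC_add_left[of 0 0 x] by simp

lemma bounded_linear_cinner_left: "bounded_linear (\<lambda>x. cinner x (y :: 'a :: chilbert_space))"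
  by (rule bounded_linear_intro[where K = "norm y"])
    (auto simp: cinner_add_left scaleR_scaleC cinner_scaleC_left scaleC_complex_def norm_cinner_le)

lemma bounded_linear_cinner_right: "bounded_linear (\<lambda>y. cinner (x :: 'a :: chilbert_space) y)"
  by (rule bounded_linear_intro[where K = "norm x"])
    (auto simp: cinner_add_right scaleR_scaleC cinner_scaleC_right scaleC_complex_def
      norm_cinner_le mult.commute[of "norm x"] intro: order_trans[OF norm_cinner_le])

lemmas cinner_sum_left = linear_sum[OF bounded_linear.linear[OF bounded_linear_cinner_left]]
lemmas cinner_sum_right = linear_sum[OF bounded_linear.linear[OF bounded_linear_cinner_right]]
lemmas scaleC_sum_right = linear_sum[OF bounded_linear.linear[OF bounded_linear_scaleC]]
lemmas cinner_diff_left = linear_diff[OF bounded_linear.linear[OF bounded_linear_cinner_left]]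

lemma cinner_eqI: "(\<And>y. cinner u y = cinner v y) \<Longrightarrow> u = (v :: 'a :: chilbert_space)"
  using inner_eq_zero_iff[of "u - v"] by (simp add: inner_eq_Re_cinner cinner_diff_left)

lemma cinner_eqI_right: "(\<And>x. cinner x u = cinner x v) \<Longrightarrow> u = (v :: 'a :: chilbert_space)"
  by (rule cinner_eqI) (metis cinner_commute)

lemma cinner_eq_0_orthogonal: "cinner x y = 0 \<Longrightarrow> orthogonal x (y :: 'a :: chilbert_space)"
  by (simp add: orthogonal_def inner_eq_Re_cinner)

lemma clinear_add: "clinear F \<Longrightarrow> F (x + y) = F x + F y"
  and clinear_scaleC: "clinear F \<Longrightarrow> F (c *\<^sub>C x) = c *\<^sub>C F x"
  by (simp_all add: clinear_def)

lemma clinear_sum: "(\<And>i. i \<in> I \<Longrightarrow> clinear (F i)) \<Longrightarrow> clinear (\<lambda>x. \<Sum>i\<in>I. F i x)"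
  by (simp add: clinear_def sum.distrib scaleC_sum_right)

lemma clinear_scaleC_op: "clinear F \<Longrightarrow> clinear (\<lambda>x. c *\<^sub>C F x)"
  by (simp add: clinear_def scaleC_add_right scaleC_scaleC mult.commute)

lemma clinear_limit:
  assumes "\<And>n. clinear (F n)" "\<And>x. (\<lambda>n. F n x) \<longlonglongrightarrow> G x"
  shows "clinear G"
  unfolding clinear_def
proof (intro conjI allI)
  fix x y c
  have "(\<lambda>n. F n (x + y)) \<longlonglongrightarrow> G x + G y"
    using tendsto_add[OF assms(2)[of x] assms(2)[of y]] by (simp add: clinear_add[OF assms(1)])
  then show "G (x + y) = G x + G y" by (rule LIMSEQ_unique[OF assms(2)])
  have "(\<lambda>n. F n (c *\<^sub>C x)) \<longlonglongrightarrow> c *\<^sub>C G x"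
    using bounded_linear.tendsto[OF bounded_linear_scaleC assms(2)]
    by (simp add: clinear_scaleC[OF assms(1)])
  then show "G (c *\<^sub>C x) = c *\<^sub>C G x" by (rule LIMSEQ_unique[OF assms(2)])
qed

lemma clinear_suminf:
  fixes F :: "nat \<Rightarrow> 'a :: chilbert_space \<Rightarrow>\<^sub>L 'b :: chilbert_space"
  assumes "summable F" "\<And>n. clinear (F n)"
  shows "clinear (suminf F)"
proof (rule clinear_limit)
  show "clinear (\<lambda>x. \<Sum>k<n. F k x)" for n
    by (intro clinear_sum assms)
  show "(\<lambda>n. \<Sum>k<n. F k x) \<longlonglongrightarrow> suminf F x" for x
    using bounded_linear.tendsto[OF blinfun.bounded_linear_left summable_LIMSEQ[OF assms(1)], of x]
    by (simp add: blinfun.sum_left)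
qed

text \<open>The representing vector minimizes $\|x\|^2 / 2 - \varphi(x)$; minimizing sequences are Cauchy by
  the parallelogram law.\<close>

lemma riesz_representation:
  fixes \<phi> :: "'a :: {real_inner, banach} \<Rightarrow> real"
  assumes "bounded_linear \<phi>"
  obtains z where "\<And>x. \<phi> x = inner x z"
proof -
  interpret bounded_linear \<phi> by fact
  define J where "J x = (norm x)\<^sup>2 / 2 - \<phi> x" for x
  obtain K where K: "\<And>x. norm (\<phi> x) \<le> norm x * K" "K \<ge> 0"
    using nonneg_bounded by blast
  have Jlow: "J x \<ge> - (K\<^sup>2 / 2)" for x
  proof -
    have "\<phi> x \<le> norm x * K" using K(1)[of x] by simp
    moreover have "0 \<le> (norm x - K)\<^sup>2" by simp
    ultimately show ?thesis by (simp add: J_def power2_diff algebra_simps)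
  qed
  define d where "d = (INF x. J x)"
  have bdd: "bdd_below (range J)" using Jlow by (auto intro!: bdd_belowI)
  have dle: "d \<le> J x" for x unfolding d_def by (rule cINF_lower[OF bdd]) simp
  have "\<exists>x. J x < d + 1 / Suc n" for n
    using cINF_less_iff[OF UNIV_not_empty bdd, of "d + 1 / Suc n"] by (auto simp: d_def)
  then obtain s where s: "\<And>n. J (s n) < d + 1 / Suc n" by metis
  have par: "(norm (x - y))\<^sup>2 \<le> 4 * J x + 4 * J y - 8 * d" for x y
  proof -
    have "(norm (x - y))\<^sup>2 = 4 * (J x + J y - 2 * J ((1/2) *\<^sub>R (x + y)))"
      by (simp add: J_def add scaleR power2_norm_eq_inner inner_add_left inner_add_right
          inner_diff_left inner_diff_right inner_commute algebra_simps)
    then show ?thesis using dle[of "(1/2) *\<^sub>R (x + y)"] by simp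
  qed
  have "Cauchy s"
  proof (rule metric_CauchyI)
    fix e :: real assume e: "e > 0"
    \<comment> \<open>\<open>par\<close> counts each excess over the infimum d with weight 4, so two
      excesses below \<open>e\<^sup>2 / 8\<close> keep the squared distance below
      \<open>e\<^sup>2\<close>.\<close>
    obtain N where N: "1 / Suc N < e\<^sup>2 / 8"
      using reals_Archimedean[of "e\<^sup>2 / 8"] e by (auto simp: inverse_eq_divide)
    have "dist (s m) (s n) < e" if "m \<ge> N" "n \<ge> N" for m n
    proof -
      have le: "J (s k) < d + e\<^sup>2 / 8" if "k \<ge> N" for k
      proof -
        have "1 / real (Suc k) \<le> 1 / Suc N" using that by (simp add: frac_le)
        then show ?thesis using s[of k] N by linarith
      qed
      have "(norm (s m - s n))\<^sup>2 < e\<^sup>2"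
        using par[of "s m" "s n"] le[OF that(1)] le[OF that(2)] by linarith
      then have "norm (s m - s n) < e"
        by (rule power_less_imp_less_base) (use e in simp)
      then show ?thesis by (simp add: dist_norm)
    qed
    then show "\<exists>M. \<forall>m\<ge>M. \<forall>n\<ge>M. dist (s m) (s n) < e" by blast
  qed
  then obtain z where z: "s \<longlonglongrightarrow> z" using Cauchy_convergent convergent_def by blast
  have "(\<lambda>n. J (s n)) \<longlonglongrightarrow> J z"
    unfolding J_def by (intro tendsto_intros z tendsto) simp
  moreover have "(\<lambda>n. d + 1 / Suc n) \<longlonglongrightarrow> d + 0"
    using LIMSEQ_Suc[OF lim_1_over_n[where 'a = real]] by (intro tendsto_add tendsto_const) simp
  ultimately have "J z \<le> d + 0"
    by (rule LIMSEQ_le) (use s less_imp_le in blast)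
  then have min: "J z \<le> J x" for x using dle[of x] by simp
  have "\<phi> x = inner x z" for x
  proof (rule ccontr)
    assume ne: "\<phi> x \<noteq> inner x z"
    define t where "t = \<phi> x - inner x z"
    define q where "q = (norm x)\<^sup>2"
    \<comment> \<open>The quadratic u^2 q / 2 - u t is minimal at t / q. The added 1 keeps the
      quotient defined for q = 0 and still makes J drop below its minimum.\<close>
    define u where "u = t / (q + 1)"
    have q: "q \<ge> 0" by (simp add: q_def)
    have "(norm (z + u *\<^sub>R x))\<^sup>2 = (norm z)\<^sup>2 + 2 * u * inner x z + u\<^sup>2 * q"
      unfolding q_def power2_norm_eq_inner
      by (simp add: inner_add_left inner_add_right inner_commute[of z x] power2_eq_square
          distrib_left)
    then have "J (z + u *\<^sub>R x) = J z + u\<^sup>2 * q / 2 - u * t"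
      unfolding J_def t_def add scaleR by (simp add: field_simps)
    with min[of "z + u *\<^sub>R x"] have "u * t \<le> u\<^sup>2 * q / 2" by linarith
    moreover have t: "t = u * (q + 1)" using q by (simp add: u_def)
    ultimately have "u\<^sup>2 * (q + 1) \<le> u\<^sup>2 * q / 2" by (simp add: power2_eq_square mult_ac)
    then have "u\<^sup>2 * (q + 2) \<le> 0" by (simp add: algebra_simps)
    moreover have "u \<noteq> 0" using ne q by (simp add: u_def t_def)
    then have "u\<^sup>2 * (q + 2) > 0" using q by simp
    ultimately show False by simp
  qed
  then show thesis by (rule that)
qed

text \<open>Riesz for the real inner product represents the real part of <A x, y> by a vector g y.
  Testing with i x recovers the imaginary part, and linearity of g follows because a vector is
  determined by its inner products.\<close>

lemma cadjoint_exists: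
  fixes A :: "'a :: chilbert_space \<Rightarrow>\<^sub>L 'b :: chilbert_space"
  assumes "clinear A"
  obtains B :: "'b \<Rightarrow>\<^sub>L 'a" where "clinear B" "\<And>x y. cinner (A x) y = cinner x (B y)"
proof -
  have "\<exists>z. \<forall>x. inner (A x) y = inner x z" for y
    using riesz_representation[of "\<lambda>x. inner (A x) y"]
    by (metis bounded_linear_inner_left_comp blinfun.bounded_linear_right)
  then obtain g where g: "\<And>x y. inner (A x) y = inner x (g y)" by metis
  have c: "cinner (A x) y = cinner x (g y)" for x y
  proof (rule complex_eqI)
    show "Re (cinner (A x) y) = Re (cinner x (g y))"
      using g[of x y] by (simp add: inner_eq_Re_cinner)
    show "Im (cinner (A x) y) = Im (cinner x (g y))"
      using g[of "\<i> *\<^sub>C x" y]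
      by (simp add: inner_eq_Re_cinner clinear_scaleC[OF assms] cinner_scaleC_left)
  qed
  have add: "g (x + y) = g x + g y" for x y
    by (rule cinner_eqI_right) (simp add: c[symmetric] cinner_add_right)
  have scale: "g (k *\<^sub>C x) = k *\<^sub>C g x" for k x
    by (rule cinner_eqI_right) (simp add: c[symmetric] cinner_scaleC_right)
  have bound: "norm (g y) \<le> norm y * norm A" for y
  proof -
    have "norm (g y) * norm (g y) = inner (A (g y)) y"
      by (simp add: g power2_norm_eq_inner[symmetric] power2_eq_square)
    also have "\<dots> \<le> norm (A (g y)) * norm y"
      using Cauchy_Schwarz_ineq2 abs_le_D1 by blast
    also have "\<dots> \<le> norm A * norm (g y) * norm y"
      by (intro mult_right_mono norm_blinfun) simp
    finally have "norm (g y) * norm (g y) \<le> norm (g y) * (norm y * norm A)" by (simp add: mult_ac)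
    then show ?thesis by (cases "g y = 0") (auto simp: mult_le_cancel_left)
  qed
  have "bounded_linear g"
    by (rule bounded_linear_intro[where K = "norm A"]) (auto simp: add scale scaleR_scaleC bound)
  then have "blinfun_apply (Blinfun g) = g" by (rule bounded_linear_Blinfun_apply)
  then show thesis
    using that[of "Blinfun g"] add scale c by (simp add: clinear_def)
qed

lemma
  fixes A :: "'a :: chilbert_space \<Rightarrow>\<^sub>L 'b :: chilbert_space"
  assumes "clinear A"
  shows clinear_cadjoint: "clinear (cadjoint A)"
    and cinner_cadjoint: "cinner (A x) y = cinner x (cadjoint A y)"
proof -
  obtain B :: "'b \<Rightarrow>\<^sub>L 'a" where B: "clinear B" "\<And>x y. cinner (A x) y = cinner x (B y)"
    using cadjoint_exists[OF assms] by blast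
  have "cadjoint A = B"
    unfolding cadjoint_def
  proof (rule the_equality)
    fix C :: "'b \<Rightarrow>\<^sub>L 'a"
    assume "clinear C \<and> (\<forall>x y. cinner (A x) y = cinner x (C y))"
    then have "cinner x (C y) = cinner x (B y)" for x y using B(2)[of x y] by simp
    then show "C = B" by (rule blinfun_eqI[OF cinner_eqI_right])
  qed (simp add: B)
  then show "clinear (cadjoint A)" "cinner (A x) y = cinner x (cadjoint A y)"
    using B by simp_all
qed

lemma clinear_word_op:
  fixes T :: "'n \<Rightarrow> 'h :: chilbert_space \<Rightarrow>\<^sub>L 'h"
  shows "(\<And>i. clinear (T i)) \<Longrightarrow> clinear (word_op T \<alpha>)"
  by (induction \<alpha>) (auto simp: clinear_def)

lemma word_op_append: "word_op T (\<alpha> @ \<beta>) = word_op T \<alpha> o\<^sub>L word_op T \<beta>"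
  by (induction \<alpha>) (simp_all add: blinfun_eqI)

section \<open>Row operators and the joint spectral radius\<close>

text \<open>For complex-linear A_i this is the row operator of the A_i times its adjoint, so the
  square root of its norm is the row norm. The row is never formed as an operator on a direct sum;
  its norm is handled through the columns of adjoints.\<close>

definition gram :: "('i \<Rightarrow> 'a :: chilbert_space \<Rightarrow>\<^sub>L 'b :: chilbert_space) \<Rightarrow> 'i set \<Rightarrow> 'b \<Rightarrow>\<^sub>L 'b" where
  "gram A I = (\<Sum>i\<in>I. A i o\<^sub>L cadjoint (A i))"

lemma cinner_gram:
  fixes A :: "'i \<Rightarrow> 'a :: chilbert_space \<Rightarrow>\<^sub>L 'b :: chilbert_space"
  assumes "\<And>i. clinear (A i)"
  shows "cinner (gram A I x) y = (\<Sum>i\<in>I. cinner (cadjoint (A i) x) (cadjoint (A i) y))"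
  by (simp add: gram_def blinfun.sum_left cinner_sum_left cinner_cadjoint[OF assms])

lemma sum_norm_cadjoint_le:
  fixes A :: "'i \<Rightarrow> 'a :: chilbert_space \<Rightarrow>\<^sub>L 'b :: chilbert_space"
  assumes "\<And>i. clinear (A i)"
  shows "(\<Sum>i\<in>I. (norm (cadjoint (A i) y))\<^sup>2) \<le> norm (gram A I) * (norm y)\<^sup>2"
proof -
  have "(\<Sum>i\<in>I. (norm (cadjoint (A i) y))\<^sup>2) = Re (cinner (gram A I y) y)"
    by (simp add: cinner_gram[OF assms] cinner_self)
  also have "\<dots> \<le> norm (gram A I y) * norm y"
    using complex_Re_le_cmod norm_cinner_le order_trans by blast
  also have "\<dots> \<le> norm (gram A I) * norm y * norm y"
    by (intro mult_right_mono norm_blinfun) simp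
  finally show ?thesis by (simp add: power2_eq_square mult.assoc)
qed

lemma norm_le_of_square_le:
  fixes z :: "'a :: real_normed_vector"
  assumes "(norm z)\<^sup>2 \<le> C * norm z" "C \<ge> 0"
  shows "norm z \<le> C"
  using assms by (cases "z = 0") (auto simp: power2_eq_square)

lemma sum_norm_mult_le:
  "(\<Sum>i\<in>I. norm (x i) * norm (y i)) \<le> sqrt (\<Sum>i\<in>I. (norm (x i))\<^sup>2) * sqrt (\<Sum>i\<in>I. (norm (y i))\<^sup>2)"
  using L2_set_mult_ineq[of "\<lambda>i. norm (x i)" "\<lambda>i. norm (y i)" I] by (simp add: L2_set_def)

text \<open>Converse of \<open>sum_norm_cadjoint_le\<close>; together they identify
  \<open>norm (gram A I)\<close> as the least such M. For z the image of y, the square of norm z is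
  the positive form at (y, z), so Cauchy-Schwarz over I bounds it by the values at (y, y) and (z,
  z), and a factor norm z cancels.\<close>

lemma norm_gram_le:
  fixes A :: "'i \<Rightarrow> 'a :: chilbert_space \<Rightarrow>\<^sub>L 'b :: chilbert_space"
  assumes "\<And>i. clinear (A i)" "M \<ge> 0"
    and M: "\<And>y. (\<Sum>i\<in>I. (norm (cadjoint (A i) y))\<^sup>2) \<le> M * (norm y)\<^sup>2"
  shows "norm (gram A I) \<le> M"
proof (rule norm_blinfun_bound[OF assms(2)])
  fix y
  define z where "z = gram A I y"
  have s: "sqrt (\<Sum>i\<in>I. (norm (cadjoint (A i) y))\<^sup>2) \<le> sqrt M * norm y" for y
    using real_sqrt_le_mono[OF M[of y]] by (simp add: real_sqrt_mult)
  have "(norm z)\<^sup>2 = Re (\<Sum>i\<in>I. cinner (cadjoint (A i) y) (cadjoint (A i) z))"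
    using arg_cong[OF cinner_self[of z], of Re]
    by (simp add: z_def cinner_gram[OF assms(1), symmetric])
  also have "\<dots> \<le> (\<Sum>i\<in>I. norm (cadjoint (A i) y) * norm (cadjoint (A i) z))"
    unfolding Re_sum by (intro sum_mono order_trans[OF complex_Re_le_cmod norm_cinner_le])
  also have "\<dots> \<le> sqrt M * norm y * (sqrt M * norm z)"
    by (intro order_trans[OF sum_norm_mult_le] mult_mono s) (simp_all add: sum_nonneg assms(2))
  also have "\<dots> = M * norm y * norm z"
    using assms(2) by (simp add: mult_ac real_sqrt_mult_self)
  finally show "norm (gram A I y) \<le> M * norm y"
    unfolding z_def using assms(2) by (intro norm_le_of_square_le) simp_all
qed

text \<open>The operator is the column x -> (c_i x) followed by the row of the A_i, and the two
  factors bound these two maps. Pairing the image z with itself moves each A_i to its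
  adjoint.\<close>

lemma norm_row_le:
  fixes A :: "'i \<Rightarrow> 'a :: chilbert_space \<Rightarrow>\<^sub>L 'b :: chilbert_space"
  assumes "\<And>i. clinear (A i)"
  shows "norm (\<Sum>i\<in>I. scaleC_blinfun (c i) (A i))
    \<le> sqrt (\<Sum>i\<in>I. (cmod (c i))\<^sup>2) * sqrt (norm (gram A I))"
proof (rule norm_blinfun_bound)
  fix x
  define z where "z = (\<Sum>i\<in>I. scaleC_blinfun (c i) (A i)) x"
  have z: "z = (\<Sum>i\<in>I. A i (c i *\<^sub>C x))"
    by (simp add: z_def blinfun.sum_left scaleC_blinfun.rep_eq clinear_scaleC[OF assms])
  have s: "sqrt (\<Sum>i\<in>I. (norm (cadjoint (A i) z))\<^sup>2) \<le> sqrt (norm (gram A I)) * norm z"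
    using real_sqrt_le_mono[OF sum_norm_cadjoint_le[of A z I]] assms by (simp add: real_sqrt_mult)
  have "cinner z z = (\<Sum>i\<in>I. cinner (c i *\<^sub>C x) (cadjoint (A i) z))"
    by (subst z) (simp add: cinner_sum_left cinner_cadjoint[OF assms])
  then have "(norm z)\<^sup>2 = Re (\<Sum>i\<in>I. cinner (c i *\<^sub>C x) (cadjoint (A i) z))"
    using arg_cong[OF cinner_self[of z], of Re] by simp
  also have "\<dots> \<le> (\<Sum>i\<in>I. norm (c i *\<^sub>C x) * norm (cadjoint (A i) z))"
    unfolding Re_sum by (intro sum_mono order_trans[OF complex_Re_le_cmod norm_cinner_le])
  also have "\<dots> \<le> sqrt (\<Sum>i\<in>I. (norm (c i *\<^sub>C x))\<^sup>2) * (sqrt (norm (gram A I)) * norm z)"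
    by (intro order_trans[OF sum_norm_mult_le] mult_left_mono s) (simp add: sum_nonneg)
  also have "sqrt (\<Sum>i\<in>I. (norm (c i *\<^sub>C x))\<^sup>2) = sqrt (\<Sum>i\<in>I. (cmod (c i))\<^sup>2) * norm x"
    by (simp add: norm_scaleC power_mult_distrib sum_distrib_right[symmetric] real_sqrt_mult)
  finally have "(norm z)\<^sup>2
    \<le> (sqrt (\<Sum>i\<in>I. (cmod (c i))\<^sup>2) * sqrt (norm (gram A I)) * norm x) * norm z"
    by (simp add: mult_ac)
  then show "norm ((\<Sum>i\<in>I. scaleC_blinfun (c i) (A i)) x)
    \<le> sqrt (\<Sum>i\<in>I. (cmod (c i))\<^sup>2) * sqrt (norm (gram A I)) * norm x"
    unfolding z_def by (rule norm_le_of_square_le) (simp add: sum_nonneg)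
qed (simp add: sum_nonneg)

section \<open>Submultiplicativity of the row norms over words of fixed length\<close>

lemma cadjoint_compose:
  fixes A :: "'b :: chilbert_space \<Rightarrow>\<^sub>L 'c :: chilbert_space" and B :: "'a :: chilbert_space \<Rightarrow>\<^sub>L 'b"
  assumes "clinear A" "clinear B"
  shows "cadjoint (A o\<^sub>L B) y = cadjoint B (cadjoint A y)"
proof (rule cinner_eqI_right)
  fix x
  have "clinear (A o\<^sub>L B)"
    using assms by (simp add: clinear_def)
  then have "cinner x (cadjoint (A o\<^sub>L B) y) = cinner ((A o\<^sub>L B) x) y"
    by (simp only: cinner_cadjoint)
  then show "cinner x (cadjoint (A o\<^sub>L B) y) = cinner x (cadjoint B (cadjoint A y))"
    by (simp add: cinner_cadjoint[OF assms(1)] cinner_cadjoint[OF assms(2)])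
qed

lemma finite_words [simp]: "finite (words k :: 'n :: finite list set)"
  using finite_lists_length_eq[of "UNIV :: 'n set" k] by (simp add: words_def)

lemma sum_words_add:
  "(\<Sum>\<gamma>\<in>words (j + k). f \<gamma>) = (\<Sum>\<alpha>\<in>words j. \<Sum>\<beta>\<in>words k. f (\<alpha> @ \<beta>))"
  for f :: "'n :: finite list \<Rightarrow> 'a :: comm_monoid_add"
  unfolding sum.cartesian_product
  by (rule sum.reindex_bij_witness[of _ "\<lambda>(\<alpha>, \<beta>). \<alpha> @ \<beta>" "\<lambda>\<gamma>. (take j \<gamma>, drop j \<gamma>)"])
    (auto simp: words_def)

text \<open>A word of length j + k splits uniquely, and the adjoint of a concatenation applies the
  adjoint of the prefix first. Summing over suffixes for a fixed prefix costs the factor for k,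
  summing over prefixes the factor for j.\<close>

lemma gram_words_submultiplicative:
  fixes T :: "'n :: finite \<Rightarrow> 'h :: chilbert_space \<Rightarrow>\<^sub>L 'h"
  assumes "\<And>i. clinear (T i)"
  shows "norm (gram (word_op T) (words (j + k)))
    \<le> norm (gram (word_op T) (words j)) * norm (gram (word_op T) (words k))"
proof (rule norm_gram_le)
  note lin = clinear_word_op[OF assms]
  show "clinear (word_op T \<alpha>)" for \<alpha> by (rule lin)
  fix y
  have "(\<Sum>\<gamma>\<in>words (j + k). (norm (cadjoint (word_op T \<gamma>) y))\<^sup>2)
    = (\<Sum>\<alpha>\<in>words j. \<Sum>\<beta>\<in>words k. (norm (cadjoint (word_op T \<beta>) (cadjoint (word_op T \<alpha>) y)))\<^sup>2)"
    by (simp add: sum_words_add word_op_append cadjoint_compose lin)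
  also have "\<dots> \<le> (\<Sum>\<alpha>\<in>words j. norm (gram (word_op T) (words k)) * (norm (cadjoint (word_op T \<alpha>) y))\<^sup>2)"
    by (intro sum_mono sum_norm_cadjoint_le lin)
  also have "\<dots> \<le> norm (gram (word_op T) (words k)) * (norm (gram (word_op T) (words j)) * (norm y)\<^sup>2)"
    unfolding sum_distrib_left[symmetric] by (intro mult_left_mono sum_norm_cadjoint_le lin) simp
  finally show "(\<Sum>\<gamma>\<in>words (j + k). (norm (cadjoint (word_op T \<gamma>) y))\<^sup>2)
    \<le> norm (gram (word_op T) (words j)) * norm (gram (word_op T) (words k)) * (norm y)\<^sup>2"
    by (simp add: mult_ac)
qed simp

text \<open>Fekete's lemma in multiplicative form: the limit is the infimum of the roots.\<close>

lemma submultiplicative_root_convergent: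
  fixes c :: "nat \<Rightarrow> real"
  assumes nonneg: "\<And>k. c k \<ge> 0" and submult: "\<And>j k. c (j + k) \<le> c j * c k"
  shows "convergent (\<lambda>k. root k (c k))"
proof -
  define L where "L = (INF k\<in>{1..}. root k (c k))"
  have bdd: "bdd_below ((\<lambda>k. root k (c k)) ` {1..})"
    using nonneg by (intro bdd_belowI2[where m = 0]) simp
  have L_le: "L \<le> root k (c k)" if "k \<ge> 1" for k
    unfolding L_def by (rule cINF_lower[OF bdd]) (use that in simp)
  have L_nonneg: "L \<ge> 0"
    unfolding L_def by (rule cINF_greatest) (use nonneg in auto)
  have upper: "\<forall>\<^sub>F k in sequentially. root k (c k) < L + e" if e: "e > 0" for e
  proof -
    \<comment> \<open>Halfway between L and the target: some root lies below b since b > L, and a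
      constant factor, whose k-th root tends to 1, still fits between b and L + e.\<close>
    define b where "b = L + e / 2"
    have b: "b > 0" using L_nonneg e by (simp add: b_def)
    have "\<exists>m\<in>{1..}. root m (c m) < b"
      using cINF_less_iff[OF _ bdd, of b] e by (auto simp: b_def L_def)
    then obtain m where m: "m \<ge> 1" "root m (c m) < b" by auto
    have "c m = root m (c m) ^ m" using m(1) nonneg by (simp add: real_root_pow_pos2)
    also have "\<dots> \<le> b ^ m" using m nonneg by (intro power_mono) auto
    finally have cm: "c m \<le> b ^ m" .
    \<comment> \<open>M dominates \<open>c r / b ^ r\<close> for every remainder r < m, a sum
      replacing the maximum. The added 1 makes M positive, as \<open>root k M\<close> must tend to
      1.\<close>
    define M where "M = 1 + (\<Sum>r<m. c r / b ^ r)"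
    have M: "M > 0" unfolding M_def using nonneg b by (intro add_pos_nonneg sum_nonneg) auto
    \<comment> \<open>Blocks of length m are split off one at a time, each costing
      \<open>b ^ m\<close>; strong induction replaces division of k by m with remainder.\<close>
    have geometric: "c k \<le> M * b ^ k" for k
    proof (induction k rule: less_induct)
      case (less k)
      show ?case
      proof (cases "k < m")
        case True
        have "c k / b ^ k \<le> (\<Sum>r<m. c r / b ^ r)"
          by (rule member_le_sum) (use True nonneg b in auto)
        then have "c k / b ^ k \<le> M" by (simp add: M_def)
        then show ?thesis using b by (simp add: field_simps)
      next
        case False
        have "c k \<le> c m * c (k - m)" using submult[of m "k - m"] False by simp
        also have "\<dots> \<le> b ^ m * (M * b ^ (k - m))"
          by (intro mult_mono cm less.IH) (use m False nonneg b in auto)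
        also have "\<dots> = M * (b ^ m * b ^ (k - m))" by (simp add: mult_ac)
        also have "\<dots> = M * b ^ k" using False by (simp add: power_add[symmetric])
        finally show ?thesis .
      qed
    qed
    have "(\<lambda>k. root k M * b) \<longlonglongrightarrow> 1 * b"
      by (intro tendsto_mult LIMSEQ_root_const M tendsto_const)
    then have "\<forall>\<^sub>F k in sequentially. root k M * b < L + e"
      by (rule order_tendstoD(2)) (use e in \<open>simp add: b_def\<close>)
    then show ?thesis using eventually_gt_at_top[of 0]
    proof eventually_elim
      case (elim k)
      have "root k (c k) \<le> root k (M * b ^ k)" using geometric elim by simp
      also have "\<dots> = root k M * b" using elim b by (simp add: real_root_mult real_root_power_cancel)
      finally show ?case using elim by simp
    qed
  qed
  have "(\<lambda>k. root k (c k)) \<longlonglongrightarrow> L"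
  proof (rule order_tendstoI)
    fix e assume "e < L"
    then show "\<forall>\<^sub>F k in sequentially. e < root k (c k)"
      by (intro eventually_mono[OF eventually_ge_at_top[of 1]] less_le_trans[OF _ L_le]) simp
  next
    fix e assume "L < e"
    then show "\<forall>\<^sub>F k in sequentially. root k (c k) < e" using upper[of "e - L"] by simp
  qed
  then show ?thesis by (auto simp: convergent_def)
qed

lemma summable_of_root_less:
  fixes c :: "nat \<Rightarrow> real"
  assumes nonneg: "\<And>k. c k \<ge> 0" and "\<rho> < 1" and ev: "\<forall>\<^sub>F k in sequentially. root k (c k) \<le> \<rho>"
  shows "summable c"
proof -
  have ge: "\<rho> \<ge> 0"
    using eventually_happens'[OF sequentially_bot ev] nonneg by (meson order_trans real_root_ge_zero)
  have "\<forall>\<^sub>F k in sequentially. norm (c k) \<le> \<rho> ^ k"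
    using ev eventually_gt_at_top[of 0]
  proof eventually_elim
    case (elim k)
    have "c k = root k (c k) ^ k" using elim nonneg by (simp add: real_root_pow_pos2)
    also have "\<dots> \<le> \<rho> ^ k" using elim nonneg by (intro power_mono) auto
    finally show ?case using nonneg by simp
  qed
  moreover have "summable (\<lambda>k. \<rho> ^ k)" using ge assms(2) by (simp add: summable_geometric)
  ultimately show ?thesis by (rule summable_comparison_test_ev)
qed

text \<open>The radius is a \<open>lim\<close>, which carries information only once convergence is
  known; Fekete's lemma for the row norms supplies it. Any number between the radius and 1 then
  serves in the root test.\<close>

lemma joint_spectral_radius_summable:
  fixes T :: "'n :: finite \<Rightarrow> 'h :: chilbert_space \<Rightarrow>\<^sub>L 'h"
  assumes "\<And>i. clinear (T i)" "joint_spectral_radius T < 1"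
  shows "summable (\<lambda>k. sqrt (norm (gram (word_op T) (words k))))"
proof -
  define c where "c k = sqrt (norm (gram (word_op T) (words k)))" for k
  have "convergent (\<lambda>k. root k (c k))"
    using gram_words_submultiplicative[OF assms(1)]
    by (intro submultiplicative_root_convergent) (auto simp: c_def real_sqrt_mult[symmetric])
  then have "(\<lambda>k. root k (c k)) \<longlonglongrightarrow> lim (\<lambda>k. root k (c k))"
    by (simp add: convergent_LIMSEQ_iff)
  moreover have "root k (c k) = root (2 * k) (norm (gram (word_op T) (words k)))" for k
    unfolding c_def sqrt_def by (metis mult.commute real_root_mult_exp)
  ultimately have lim: "(\<lambda>k. root k (c k)) \<longlonglongrightarrow> joint_spectral_radius T"
    by (simp add: joint_spectral_radius_def gram_def)
  obtain \<rho> where \<rho>: "joint_spectral_radius T < \<rho>" "\<rho> < 1" using assms(2) dense by blast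
  have "summable c"
    using order_tendstoD(2)[OF lim \<rho>(1)]
    by (intro summable_of_root_less[OF _ \<rho>(2)]) (auto simp: c_def elim: eventually_mono)
  then show ?thesis by (simp add: c_def[abs_def])
qed

section \<open>Tensor products of operators on Fock space\<close>

text \<open>Cauchy criterion for unordered sums: a finite set containing F0 differs from it by a set
  disjoint from F0. Absolute summability would be too strong, since the norms in an orthogonal
  series are in general only square summable.\<close>

lemma summable_on_of_small_tails:
  fixes f :: "'i \<Rightarrow> 'b :: banach"
  assumes tail: "\<And>e. e > 0 \<Longrightarrow>
    \<exists>F0. finite F0 \<and> F0 \<subseteq> A \<and> (\<forall>G. finite G \<longrightarrow> G \<subseteq> A \<longrightarrow> G \<inter> F0 = {} \<longrightarrow> norm (sum f G) < e)"
  shows "f summable_on A"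
proof -
  have "\<exists>P. eventually P (finite_subsets_at_top A) \<and>
      (\<forall>F F'. P F \<and> P F' \<longrightarrow> dist (sum f F) (sum f F') < e)" if e: "e > 0" for e
  proof -
    obtain F0 where F0: "finite F0" "F0 \<subseteq> A"
      and small: "\<And>G. finite G \<Longrightarrow> G \<subseteq> A \<Longrightarrow> G \<inter> F0 = {} \<Longrightarrow> norm (sum f G) < e / 2"
      using tail[of "e / 2"] e by auto
    define P where "P F \<longleftrightarrow> finite F \<and> F0 \<subseteq> F \<and> F \<subseteq> A" for F
    have "eventually P (finite_subsets_at_top A)"
      unfolding eventually_finite_subsets_at_top using F0 by (intro exI[of _ F0]) (auto simp: P_def)
    moreover have half: "dist (sum f F) (sum f F0) < e / 2" if "P F" for F
      using that small[of "F - F0"] by (auto simp: P_def dist_norm sum_diff)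
    have "dist (sum f F) (sum f F') < e" if "P F" "P F'" for F F'
      using half[OF that(1)] half[OF that(2)] by (metis dist_commute dist_triangle_half_l)
    ultimately show ?thesis by blast
  qed
  then have "cauchy_filter (filtermap (sum f) (finite_subsets_at_top A))"
    by (simp add: cauchy_filter_metric_filtermap)
  moreover have "complete (UNIV :: 'b set)"
    by (meson Cauchy_convergent UNIV_I complete_def convergent_def)
  ultimately obtain L where "(sum f \<longlongrightarrow> L) (finite_subsets_at_top A)"
    using complete_uniform[where S = UNIV] by (force simp add: filterlim_def)
  then show ?thesis by (auto simp: summable_on_def has_sum_def)
qed

text \<open>In the applications s holds the squared coordinate norms of a vector, and the square
  bound comes from orthogonality or from a bounded operator. Convergence and the norm estimate are
  then obtained together.\<close>

lemma
  fixes f :: "'i \<Rightarrow> 'b :: banach" and s :: "'i \<Rightarrow> real"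
  assumes s: "s summable_on A" "\<And>i. s i \<ge> 0" and C: "C \<ge> 0"
    and le: "\<And>F. finite F \<Longrightarrow> F \<subseteq> A \<Longrightarrow> (norm (sum f F))\<^sup>2 \<le> C * sum s F"
  shows summable_on_of_square_bound: "f summable_on A"
    and norm_infsum_square_le: "(norm (infsum f A))\<^sup>2 \<le> C * infsum s A"
proof -
  show sum_f: "f summable_on A"
  proof (rule summable_on_of_small_tails)
    fix e :: real assume e: "e > 0"
    \<comment> \<open>Solves (C + 1) * 2 \<delta> = \<open>e\<^sup>2\<close>; using C + 1 in place
      of C admits C = 0.\<close>
    define \<delta> where "\<delta> = e\<^sup>2 / (2 * (C + 1))"
    have \<delta>: "\<delta> > 0" using e C by (simp add: \<delta>_def)
    obtain F0 where F0: "finite F0" "F0 \<subseteq> A" "dist (sum s F0) (infsum s A) \<le> \<delta>"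
      using infsum_finite_approximation[OF s(1) \<delta>] by blast
    have "norm (sum f G) < e" if G: "finite G" "G \<subseteq> A" "G \<inter> F0 = {}" for G
    proof -
      have "sum s F0 + sum s G = sum s (F0 \<union> G)"
        using G F0 by (subst sum.union_disjoint) auto
      also have "\<dots> \<le> infsum s A"
        using G F0 s by (intro finite_sum_le_infsum) auto
      finally have "sum s G \<le> \<delta>" using F0(3) by (simp add: dist_real_def)
      then have "C * sum s G \<le> C * \<delta>" using C by (rule mult_left_mono)
      also have "\<dots> < (C + 1) * (2 * \<delta>)" using C \<delta> by (simp add: algebra_simps add_nonneg_pos)
      also have "\<dots> = e\<^sup>2" using C by (simp add: \<delta>_def field_simps)
      finally have "(norm (sum f G))\<^sup>2 < e\<^sup>2" using le[OF G(1,2)] by linarith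
      then show ?thesis by (rule power_less_imp_less_base) (use e in simp)
    qed
    then show "\<exists>F0. finite F0 \<and> F0 \<subseteq> A \<and>
        (\<forall>G. finite G \<longrightarrow> G \<subseteq> A \<longrightarrow> G \<inter> F0 = {} \<longrightarrow> norm (sum f G) < e)"
      using F0 by blast
  qed
  show "(norm (infsum f A))\<^sup>2 \<le> C * infsum s A"
  proof (rule tendsto_upperbound)
    show "((\<lambda>F. (norm (sum f F))\<^sup>2) \<longlongrightarrow> (norm (infsum f A))\<^sup>2) (finite_subsets_at_top A)"
      using sum_f by (intro tendsto_power tendsto_norm infsum_tendsto)
    show "\<forall>\<^sub>F F in finite_subsets_at_top A. (norm (sum f F))\<^sup>2 \<le> C * infsum s A"
    proof (rule eventually_finite_subsets_at_top_weakI)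
      fix F assume F: "finite F" "F \<subseteq> A"
      have "sum s F \<le> infsum s A" using F s by (intro finite_sum_le_infsum) auto
      then show "(norm (sum f F))\<^sup>2 \<le> C * infsum s A"
        using le[OF F] C by (meson mult_left_mono order_trans)
    qed
  qed simp
qed

section \<open>Elementary tensors and coordinate expansions in Fock space\<close>

lemma norm_tensor: "norm (tensor \<xi> x) = norm \<xi> * norm x"
proof -
  have "complex_of_real ((norm (tensor \<xi> x))\<^sup>2) = complex_of_real ((norm \<xi> * norm x)\<^sup>2)"
    by (simp only: cinner_self[symmetric] cinner_tensor) (simp add: cinner_self power_mult_distrib)
  then show ?thesis by (simp only: of_real_eq_iff) (simp add: power2_eq_iff_nonneg)
qed

lemma tensor_add_left: "tensor (\<xi> + \<eta>) x = tensor \<xi> x + tensor \<eta> x"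
  by transfer (simp add: scaleC_add_left)

lemma tensor_add_right: "tensor \<xi> (x + y) = tensor \<xi> x + tensor \<xi> y"
  by transfer (simp add: scaleC_add_right)

lemma tensor_scaleC_left: "tensor (c *\<^sub>C \<xi>) x = c *\<^sub>C tensor \<xi> x"
  by transfer (simp add: scaleC_complex_def scaleC_scaleC)

lemma tensor_scaleC_right: "tensor \<xi> (c *\<^sub>C x) = c *\<^sub>C tensor \<xi> x"
  by transfer (simp add: scaleC_scaleC mult.commute)

lemma bounded_linear_tensor_left: "bounded_linear (\<lambda>\<xi>. tensor \<xi> x)"
  by (rule bounded_linear_intro[where K = "norm x"])
    (simp_all add: tensor_add_left scaleR_scaleC tensor_scaleC_left norm_tensor)

lemma bounded_linear_tensor_right: "bounded_linear (\<lambda>x. tensor \<xi> x)"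
  by (rule bounded_linear_intro[where K = "norm \<xi>"])
    (simp_all add: tensor_add_right scaleR_scaleC tensor_scaleC_right norm_tensor)

lemma bounded_linear_Rep_ell2: "bounded_linear (\<lambda>v. Rep_ell2 v i)"
  by (rule bounded_linear_intro[where K = 1])
    (simp_all add: plus_ell2.rep_eq scaleR_ell2.rep_eq ell2_norm_coord_le)

lemmas Rep_ell2_sum = linear_sum[OF bounded_linear.linear[OF bounded_linear_Rep_ell2]]

lemma ell2_eqI: "(\<And>i. Rep_ell2 v i = Rep_ell2 w i) \<Longrightarrow> v = w"
  by (simp add: Rep_ell2_inject[symmetric] fun_eq_iff)

lemma Rep_tensor_fock_basis:
  "Rep_ell2 (tensor (fock_basis \<alpha>) x) \<beta> = (if \<beta> = \<alpha> then x else 0)"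
  by (simp add: tensor.rep_eq fock_basis.rep_eq scaleC_one)

lemma cinner_fock_basis_right: "cinner \<xi> (fock_basis \<alpha>) = Rep_ell2 \<xi> \<alpha>"
proof transfer
  fix \<xi> :: "'a list \<Rightarrow> complex" and \<alpha>
  have "(\<Sum>\<^sub>\<infinity>\<beta>. cinner (\<xi> \<beta>) (if \<beta> = \<alpha> then 1 else 0)) = (\<Sum>\<^sub>\<infinity>\<beta>\<in>{\<alpha>}. \<xi> \<beta>)"
    by (rule infsum_cong_neutral) (auto simp: cinner_complex_def)
  then show "(\<Sum>\<^sub>\<infinity>\<beta>. cinner (\<xi> \<beta>) (if \<beta> = \<alpha> then 1 else 0)) = \<xi> \<alpha>" by simp
qed

lemma cinner_fock_basis: "cinner (fock_basis \<alpha>) (fock_basis \<beta>) = (if \<alpha> = \<beta> then 1 else 0)"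
  by (simp add: cinner_fock_basis_right fock_basis.rep_eq)

lemma norm_fock_basis [simp]: "norm (fock_basis \<alpha>) = 1"
  using arg_cong[OF cinner_self[of "fock_basis \<alpha>"], of Re]
  by (simp add: cinner_fock_basis power2_eq_1_iff) (smt (verit) norm_ge_zero)

text \<open>Distinct basis words give orthogonal summands, so the square bound holds with constant
  1; continuity of the coordinates identifies the sum as v. This is the tool for passing from basis
  tensors to all vectors.\<close>

lemma fock_has_sum:
  fixes v :: "('n list, 'h :: chilbert_space) ell2"
  shows "((\<lambda>\<alpha>. tensor (fock_basis \<alpha>) (Rep_ell2 v \<alpha>)) has_sum v) UNIV"
proof -
  let ?f = "\<lambda>\<alpha>. tensor (fock_basis \<alpha>) (Rep_ell2 v \<alpha>)"
  have "(norm (sum ?f F))\<^sup>2 \<le> 1 * (\<Sum>\<alpha>\<in>F. (norm (Rep_ell2 v \<alpha>))\<^sup>2)" if "finite F" for F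
    using that
    by (subst norm_sum_Pythagorean)
      (auto simp: norm_tensor pairwise_def cinner_tensor cinner_fock_basis intro!: cinner_eq_0_orthogonal)
  then have summable: "?f summable_on UNIV"
    by (intro summable_on_of_square_bound[OF Rep_ell2_summable[of v], of 1]) auto
  have "infsum ?f UNIV = v"
  proof (rule ell2_eqI)
    fix \<beta>
    have "((\<lambda>\<alpha>. Rep_ell2 (?f \<alpha>) \<beta>) has_sum Rep_ell2 (infsum ?f UNIV) \<beta>) UNIV"
      using summable by (intro has_sum_bounded_linear[OF bounded_linear_Rep_ell2]) simp
    then have "Rep_ell2 (infsum ?f UNIV) \<beta> = (\<Sum>\<^sub>\<infinity>\<alpha>. if \<beta> = \<alpha> then Rep_ell2 v \<alpha> else 0)"
      by (simp add: Rep_tensor_fock_basis infsumI)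
    also have "\<dots> = (\<Sum>\<^sub>\<infinity>\<alpha>\<in>{\<beta>}. Rep_ell2 v \<alpha>)" by (rule infsum_cong_neutral) auto
    finally show "Rep_ell2 (infsum ?f UNIV) \<beta> = Rep_ell2 v \<beta>" by simp
  qed
  then show ?thesis using summable by (metis has_sum_infsum)
qed

lemma tensor_complex: "tensor \<xi> c = c *\<^sub>C \<xi>" for \<xi> :: "('i, complex) ell2"
  by transfer (simp add: scaleC_complex_def mult.commute)

lemma fock_expansion: "((\<lambda>\<alpha>. Rep_ell2 \<xi> \<alpha> *\<^sub>C fock_basis \<alpha>) has_sum \<xi>) UNIV"
  using fock_has_sum[of \<xi>] by (simp add: tensor_complex)

text \<open>Gram-Schmidt, adding the normalised residual of one vector at a time. As U is a set and
  not a family, a vector already in the span adds nothing.\<close>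

lemma finite_orthonormal_expansion:
  fixes v :: "'j \<Rightarrow> 'h :: chilbert_space"
  assumes "finite J"
  shows "\<exists>U. finite U \<and> (\<forall>u\<in>U. \<forall>w\<in>U. cinner u w = (if u = w then 1 else 0)) \<and>
    (\<forall>j\<in>J. v j = (\<Sum>u\<in>U. cinner (v j) u *\<^sub>C u))"
  using assms
proof (induction J rule: finite_induct)
  case empty
  show ?case by (rule exI[of _ "{}"]) simp
next
  case (insert j J)
  then obtain U where U: "finite U" "\<And>u w. u \<in> U \<Longrightarrow> w \<in> U \<Longrightarrow> cinner u w = (if u = w then 1 else 0)"
    and exp: "\<And>i. i \<in> J \<Longrightarrow> v i = (\<Sum>u\<in>U. cinner (v i) u *\<^sub>C u)" by blast
  define w where "w = v j - (\<Sum>u\<in>U. cinner (v j) u *\<^sub>C u)"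
  have w_orth: "cinner w u = 0" if "u \<in> U" for u
    using that U
    by (simp add: w_def cinner_diff_left cinner_sum_left cinner_scaleC_left if_distrib[of "\<lambda>x. _ * x"]
        cong: if_cong)
  show ?case
  proof (cases "w = 0")
    case True
    then show ?thesis using U exp by (intro exI[of _ U]) (auto simp: w_def)
  next
    case False
    define n where "n = complex_of_real (1 / norm w) *\<^sub>C w"
    have nu: "cinner n u = 0" "cinner u n = 0" if "u \<in> U" for u
      using w_orth[OF that] cinner_commute[of u w]
      by (simp_all add: n_def cinner_scaleC_left cinner_scaleC_right)
    have nn: "cinner n n = 1"
      using False
      by (simp add: n_def cinner_self norm_scaleC norm_divide)
    then have "n \<notin> U" using nu by fastforce
    have vj: "v j = w + (\<Sum>u\<in>U. cinner (v j) u *\<^sub>C u)" by (simp add: w_def)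
    have "cinner (v j) n = cinner w n"
      by (subst vj) (simp add: cinner_add_left cinner_sum_left cinner_scaleC_left nu)
    also have "\<dots> = norm w"
      using False by (simp add: n_def cinner_scaleC_right cinner_self power2_eq_square)
    finally have "cinner (v j) n *\<^sub>C n = w"
      using False by (simp add: n_def scaleC_scaleC scaleC_one)
    then have expj: "v j = (\<Sum>u\<in>insert n U. cinner (v j) u *\<^sub>C u)"
      using vj U(1) \<open>n \<notin> U\<close> by simp
    \<comment> \<open>Earlier vectors are combinations of U, hence orthogonal to n, so enlarging U
      leaves their expansions unchanged.\<close>
    have "cinner (v i) n = 0" if "i \<in> J" for i
      by (subst exp[OF that]) (simp add: cinner_sum_left cinner_scaleC_left nu)
    then have "v i = (\<Sum>u\<in>insert n U. cinner (v i) u *\<^sub>C u)" if "i \<in> J" for i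
      using that exp[OF that] U(1) \<open>n \<notin> U\<close> by simp
    then show ?thesis
      using expj U nu nn \<open>n \<notin> U\<close> by (intro exI[of _ "insert n U"]) auto
  qed
qed

text \<open>Expanding the vectors \<open>v j\<close> in a common orthonormal system \<open>U\<close> reduces the bound to the one
  for \<open>A\<close> applied to the coefficient vectors.\<close>

lemma norm_sum_tensor_le:
  fixes A :: "'n fock \<Rightarrow>\<^sub>L 'n fock" and v :: "'n list \<Rightarrow> 'h :: chilbert_space"
  assumes A: "clinear A" and J: "finite J"
  shows "(norm (\<Sum>j\<in>J. tensor (A (fock_basis j)) (v j)))\<^sup>2 \<le> (norm A)\<^sup>2 * (\<Sum>j\<in>J. (norm (v j))\<^sup>2)"
proof -
  obtain U where U: "finite U" "\<And>u w. u \<in> U \<Longrightarrow> w \<in> U \<Longrightarrow> cinner u w = (if u = w then 1 else 0)"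
    and exp: "\<And>j. j \<in> J \<Longrightarrow> v j = (\<Sum>u\<in>U. cinner (v j) u *\<^sub>C u)"
    using finite_orthonormal_expansion[OF J, of v] by blast
  have norm_u: "norm u = 1" if "u \<in> U" for u
    using arg_cong[OF cinner_self[of u], of Re] U(2)[OF that that]
    by (simp add: power2_eq_1_iff) (smt (verit) norm_ge_zero)
  have norm_v: "(norm (v j))\<^sup>2 = (\<Sum>u\<in>U. (cmod (cinner (v j) u))\<^sup>2)" if "j \<in> J" for j
  proof -
    have "(norm (\<Sum>u\<in>U. cinner (v j) u *\<^sub>C u))\<^sup>2 = (\<Sum>u\<in>U. (norm (cinner (v j) u *\<^sub>C u))\<^sup>2)"
      using U by (intro norm_sum_Pythagorean pairwiseI)
        (auto intro!: cinner_eq_0_orthogonal simp: cinner_scaleC_left cinner_scaleC_right)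
    then show ?thesis
      using exp[OF that] by (simp add: norm_scaleC norm_u)
  qed
  \<comment> \<open>Regrouping by u instead of by j turns the sum into terms A (\<xi> u) tensor u,
    pairwise orthogonal in the second factor, so \<open>norm A\<close> is applied to each \<xi> u
    separately.\<close>
  define \<xi> where "\<xi> u = (\<Sum>j\<in>J. cinner (v j) u *\<^sub>C fock_basis j)" for u
  have norm_\<xi>: "(norm (\<xi> u))\<^sup>2 = (\<Sum>j\<in>J. (cmod (cinner (v j) u))\<^sup>2)" for u
    unfolding \<xi>_def using J
    by (subst norm_sum_Pythagorean)
      (auto intro!: cinner_eq_0_orthogonal
        simp: pairwise_def cinner_scaleC_left cinner_scaleC_right cinner_fock_basis norm_scaleC)
  have "(\<Sum>j\<in>J. tensor (A (fock_basis j)) (v j))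
      = (\<Sum>j\<in>J. \<Sum>u\<in>U. tensor (cinner (v j) u *\<^sub>C A (fock_basis j)) u)"
  proof (rule sum.cong)
    fix j assume "j \<in> J"
    then have "tensor (A (fock_basis j)) (v j)
      = tensor (A (fock_basis j)) (\<Sum>u\<in>U. cinner (v j) u *\<^sub>C u)"
      using exp by metis
    then show "tensor (A (fock_basis j)) (v j) = (\<Sum>u\<in>U. tensor (cinner (v j) u *\<^sub>C A (fock_basis j)) u)"
      by (simp add: linear_sum[OF bounded_linear.linear[OF bounded_linear_tensor_right]]
          tensor_scaleC_left tensor_scaleC_right)
  qed simp
  also have "\<dots> = (\<Sum>u\<in>U. tensor (A (\<xi> u)) u)"
    unfolding \<xi>_def
    by (subst sum.swap) (simp add: blinfun.sum_right clinear_scaleC[OF A]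
        linear_sum[OF bounded_linear.linear[OF bounded_linear_tensor_left]])
  finally have "(norm (\<Sum>j\<in>J. tensor (A (fock_basis j)) (v j)))\<^sup>2
      = (norm (\<Sum>u\<in>U. tensor (A (\<xi> u)) u))\<^sup>2" by simp
  also have "\<dots> = (\<Sum>u\<in>U. (norm (tensor (A (\<xi> u)) u))\<^sup>2)"
    using U by (intro norm_sum_Pythagorean pairwiseI)
      (auto intro!: cinner_eq_0_orthogonal simp: cinner_tensor)
  also have "\<dots> = (\<Sum>u\<in>U. (norm (A (\<xi> u)))\<^sup>2)"
    by (simp add: norm_tensor norm_u)
  also have "\<dots> \<le> (\<Sum>u\<in>U. (norm A)\<^sup>2 * (norm (\<xi> u))\<^sup>2)"
    unfolding power_mult_distrib[symmetric] by (intro sum_mono power_mono norm_blinfun) simp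
  also have "\<dots> = (norm A)\<^sup>2 * (\<Sum>u\<in>U. \<Sum>j\<in>J. (cmod (cinner (v j) u))\<^sup>2)"
    by (simp add: norm_\<xi> sum_distrib_left)
  also have "(\<Sum>u\<in>U. \<Sum>j\<in>J. (cmod (cinner (v j) u))\<^sup>2) = (\<Sum>j\<in>J. (norm (v j))\<^sup>2)"
    by (subst sum.swap) (simp add: norm_v)
  finally show ?thesis .
qed

text \<open>Basis tensors span a dense subspace, by \<open>fock_has_sum\<close>. This is the
  uniqueness half for \<open>tensor_op\<close> and, with scalar coefficients, for
  \<open>boundary_function\<close>.\<close>

lemma clinear_fock_tensor_eqI:
  fixes C D :: "('n list, 'h :: chilbert_space) ell2 \<Rightarrow>\<^sub>L 'b :: chilbert_space"
  assumes "\<And>\<alpha> x. C (tensor (fock_basis \<alpha>) x) = D (tensor (fock_basis \<alpha>) x)"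
  shows "C = D"
proof (rule blinfun_eqI)
  fix v
  have "((\<lambda>\<alpha>. C (tensor (fock_basis \<alpha>) (Rep_ell2 v \<alpha>))) has_sum C v) UNIV"
    "((\<lambda>\<alpha>. D (tensor (fock_basis \<alpha>) (Rep_ell2 v \<alpha>))) has_sum D v) UNIV"
    by (intro has_sum_bounded_linear[OF blinfun.bounded_linear_right] fock_has_sum)+
  then show "C v = D v" by (simp add: assms has_sum_unique)
qed

text \<open>Writing v as the sum of e_j tensor v_j leaves one candidate, the sum of A e_j tensor B
  v_j. These terms are in general not orthogonal, so convergence and boundedness both rest on
  \<open>norm_sum_tensor_le\<close>.\<close>

lemma tensor_op_exists:
  fixes A :: "'n fock \<Rightarrow>\<^sub>L 'n fock" and B :: "'h :: chilbert_space \<Rightarrow>\<^sub>L 'h"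
  assumes A: "clinear A" and B: "clinear B"
  obtains C :: "('n list, 'h) ell2 \<Rightarrow>\<^sub>L ('n list, 'h) ell2"
  where "clinear C" "\<And>\<xi> x. C (tensor \<xi> x) = tensor (A \<xi>) (B x)"
proof -
  define f where "f v j = tensor (A (fock_basis j)) (B (Rep_ell2 v j))"
    for v :: "('n list, 'h) ell2" and j
  define K where "K = (norm A * norm B)\<^sup>2"
  define c where "c v = infsum (f v) UNIV" for v
  have le: "(norm (sum (f v) F))\<^sup>2 \<le> K * (\<Sum>j\<in>F. (norm (Rep_ell2 v j))\<^sup>2)" if "finite F" for v F
  proof -
    have "(norm (sum (f v) F))\<^sup>2 \<le> (norm A)\<^sup>2 * (\<Sum>j\<in>F. (norm (B (Rep_ell2 v j)))\<^sup>2)"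
      unfolding f_def by (rule norm_sum_tensor_le[OF A that])
    also have "\<dots> \<le> (norm A)\<^sup>2 * (\<Sum>j\<in>F. (norm B * norm (Rep_ell2 v j))\<^sup>2)"
      by (intro mult_left_mono sum_mono power_mono norm_blinfun) simp_all
    finally show ?thesis by (simp add: K_def power_mult_distrib sum_distrib_left mult_ac)
  qed
  have K: "K \<ge> 0" by (simp add: K_def)
  have summable: "f v summable_on UNIV" for v
    by (rule summable_on_of_square_bound[OF Rep_ell2_summable[of v] _ K]) (use le in auto)
  have "(norm (c v))\<^sup>2 \<le> K * (norm v)\<^sup>2" for v
    unfolding c_def ell2_norm_sq[of v]
    by (rule norm_infsum_square_le[OF Rep_ell2_summable[of v] _ K]) (use le in auto)
  then have "(norm (c v))\<^sup>2 \<le> (norm v * (norm A * norm B))\<^sup>2" for v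
    by (simp add: K_def power_mult_distrib mult_ac)
  then have bound: "norm (c v) \<le> norm v * (norm A * norm B)" for v
    by (rule power2_le_imp_le) simp
  have add: "c (v + w) = c v + c w" for v w
  proof -
    have "f (v + w) = (\<lambda>j. f v j + f w j)"
      by (simp add: fun_eq_iff f_def plus_ell2.rep_eq clinear_add[OF B] tensor_add_right)
    then show ?thesis by (simp add: c_def infsum_add summable)
  qed
  have scale: "c (k *\<^sub>C v) = k *\<^sub>C c v" for k v
  proof -
    have "((\<lambda>j. k *\<^sub>C f v j) has_sum k *\<^sub>C c v) UNIV"
      unfolding c_def using summable by (intro has_sum_bounded_linear[OF bounded_linear_scaleC]) simp
    moreover have "(\<lambda>j. k *\<^sub>C f v j) = f (k *\<^sub>C v)"
      by (simp add: fun_eq_iff f_def scaleC_ell2.rep_eq clinear_scaleC[OF B] tensor_scaleC_right)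
    ultimately show ?thesis by (simp add: c_def infsumI)
  qed
  have "c (tensor \<xi> x) = tensor (A \<xi>) (B x)" for \<xi> x
  proof -
    have "((\<lambda>\<alpha>. tensor (A (Rep_ell2 \<xi> \<alpha> *\<^sub>C fock_basis \<alpha>)) (B x)) has_sum tensor (A \<xi>) (B x)) UNIV"
      using has_sum_bounded_linear[OF bounded_linear_compose[OF bounded_linear_tensor_left
            blinfun.bounded_linear_right] fock_expansion] .
    then have "(f (tensor \<xi> x) has_sum tensor (A \<xi>) (B x)) UNIV"
      by (simp add: f_def[abs_def] tensor.rep_eq clinear_scaleC[OF A] clinear_scaleC[OF B]
          tensor_scaleC_left tensor_scaleC_right)
    then show ?thesis by (simp add: c_def infsumI)
  qed
  moreover have "bounded_linear c"
    by (rule bounded_linear_intro[OF _ _ bound]) (simp_all add: add scale scaleR_scaleC)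
  then have "blinfun_apply (Blinfun c) = c" by (rule bounded_linear_Blinfun_apply)
  ultimately show thesis
    using add scale by (intro that[of "Blinfun c"]) (simp_all add: clinear_def)
qed

lemma tensor_op_tensor:
  fixes A :: "'n fock \<Rightarrow>\<^sub>L 'n fock" and B :: "'h :: chilbert_space \<Rightarrow>\<^sub>L 'h"
  assumes "clinear A" "clinear B"
  shows "tensor_op A B (tensor \<xi> x) = tensor (A \<xi>) (B x)"
proof -
  obtain C :: "('n list, 'h) ell2 \<Rightarrow>\<^sub>L ('n list, 'h) ell2"
    where C: "clinear C" "\<And>\<xi> x. C (tensor \<xi> x) = tensor (A \<xi>) (B x)"
    using tensor_op_exists[OF assms] by blast
  have "tensor_op A B = C"
    unfolding tensor_op_def
  proof (rule the_equality)
    fix D :: "('n list, 'h) ell2 \<Rightarrow>\<^sub>L ('n list, 'h) ell2"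
    assume "clinear D \<and> (\<forall>\<xi> x. D (tensor \<xi> x) = tensor (A \<xi>) (B x))"
    then show "D = C" by (intro clinear_fock_tensor_eqI) (simp add: C)
  qed (simp add: C)
  then show ?thesis by (simp add: C)
qed

section \<open>The Cauchy transform as a functional calculus\<close>

lemma clinear_right_creation: "clinear (right_creation i)"
  unfolding clinear_def
proof (intro conjI allI)
  fix \<xi> \<eta> :: "'a fock" and c
  show "right_creation i (\<xi> + \<eta>) = right_creation i \<xi> + right_creation i \<eta>"
    by (rule blinfun.add_right)
  show "right_creation i (c *\<^sub>C \<xi>) = c *\<^sub>C right_creation i \<xi>"
    unfolding right_creation.rep_eq
    by transfer (auto simp: right_shift_def fun_eq_iff scaleC_complex_def)
qed

lemma word_op_right_creation: "word_op right_creation \<alpha> (fock_basis \<beta>) = fock_basis (\<beta> @ rev \<alpha>)"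
  by (induction \<alpha>) (simp_all add: right_creation_fock_basis)

lemma sum_words_rev: "(\<Sum>\<alpha>\<in>words k. f (rev \<alpha>)) = (\<Sum>\<alpha>\<in>words k. f \<alpha>)"
  by (rule sum.reindex_bij_witness[of _ rev rev]) (auto simp: words_def)

definition kernel_term ::
    "('n :: finite \<Rightarrow> 'h :: chilbert_space \<Rightarrow>\<^sub>L 'h) \<Rightarrow> nat \<Rightarrow> ('n list, 'h) ell2 \<Rightarrow>\<^sub>L ('n list, 'h) ell2" where
  "kernel_term T k =
    (\<Sum>\<alpha>\<in>words k. tensor_op (word_op right_creation \<alpha>) (cadjoint (word_op T (rev \<alpha>))))"

context
  fixes T :: "'n :: finite \<Rightarrow> 'h :: chilbert_space \<Rightarrow>\<^sub>L 'h"
  assumes lin: "\<And>i. clinear (T i)"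
begin

lemmas clinear_word = clinear_word_op[of T, OF lin]

text \<open>The innermost right creation operator acts first, so the word operator of \<alpha>
  appends \<open>rev \<alpha>\<close>. The reversal in the kernel matches this: after reindexing by
  \<open>rev\<close>, the letters appended and the adjoint belong to the same word.\<close>

lemma kernel_term_tensor:
  "kernel_term T k (tensor (fock_basis \<beta>) x)
    = (\<Sum>\<alpha>\<in>words k. tensor (fock_basis (\<beta> @ \<alpha>)) (cadjoint (word_op T \<alpha>) x))"
  by (simp add: kernel_term_def blinfun.sum_left tensor_op_tensor clinear_word_op
      clinear_right_creation clinear_cadjoint clinear_word word_op_right_creation
      sum_words_rev[of "\<lambda>\<alpha>. tensor (fock_basis (\<beta> @ \<alpha>)) (cadjoint (word_op T \<alpha>) x)"])

text \<open>With the suffix length fixed at k, the word \<open>\<beta> @ \<alpha>\<close> determines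
  both parts, so the summands over all pairs are orthogonal. Pythagoras leaves one sum of squared
  adjoint norms for each coordinate of v.\<close>

lemma norm_kernel_term_le: "norm (kernel_term T k) \<le> sqrt (norm (gram (word_op T) (words k)))"
proof (rule norm_blinfun_bound)
  fix v :: "('n list, 'h) ell2"
  define M where "M = norm (gram (word_op T) (words k))"
  define f where "f \<beta> = kernel_term T k (tensor (fock_basis \<beta>) (Rep_ell2 v \<beta>))" for \<beta>
  have f_sum: "(f has_sum kernel_term T k v) UNIV"
    unfolding f_def
    by (intro has_sum_bounded_linear[OF blinfun.bounded_linear_right] fock_has_sum)
  have le: "(norm (sum f F))\<^sup>2 \<le> M * (\<Sum>\<beta>\<in>F. (norm (Rep_ell2 v \<beta>))\<^sup>2)" if F: "finite F" for F
  proof -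
    let ?g = "\<lambda>(\<beta>, \<alpha>). tensor (fock_basis (\<beta> @ \<alpha>)) (cadjoint (word_op T \<alpha>) (Rep_ell2 v \<beta>))"
    have append: "\<beta> @ \<alpha> = \<beta>' @ \<alpha>' \<longleftrightarrow> \<beta> = \<beta>' \<and> \<alpha> = \<alpha>'"
      if "\<alpha> \<in> words k" "\<alpha>' \<in> words k" for \<alpha> \<alpha>' \<beta> \<beta>' :: "'n list"
      using that by (simp add: words_def)
    have "sum f F = sum ?g (F \<times> words k)"
      by (simp add: f_def kernel_term_tensor sum.cartesian_product)
    also have "(norm \<dots>)\<^sup>2 = (\<Sum>p\<in>F \<times> words k. (norm (?g p))\<^sup>2)"
      using F
      by (intro norm_sum_Pythagorean)
        (auto simp: pairwise_def cinner_tensor cinner_fock_basis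
append
          intro!: cinner_eq_0_orthogonal)
    also have "\<dots> = (\<Sum>\<beta>\<in>F. \<Sum>\<alpha>\<in>words k. (norm (cadjoint (word_op T \<alpha>) (Rep_ell2 v \<beta>)))\<^sup>2)"
      unfolding sum.cartesian_product by (simp add: norm_tensor split_def)
    also have "\<dots> \<le> (\<Sum>\<beta>\<in>F. M * (norm (Rep_ell2 v \<beta>))\<^sup>2)"
      unfolding M_def by (intro sum_mono sum_norm_cadjoint_le clinear_word)
    finally show ?thesis by (simp add: sum_distrib_left)
  qed
  have "(norm (infsum f UNIV))\<^sup>2 \<le> M * (norm v)\<^sup>2"
    unfolding ell2_norm_sq[of v]
    by (rule norm_infsum_square_le[OF Rep_ell2_summable]) (use le in \<open>auto simp: M_def\<close>)
  then have "(norm (kernel_term T k v))\<^sup>2 \<le> (sqrt M * norm v)\<^sup>2"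
    using f_sum by (simp add: infsumI power_mult_distrib M_def)
  then show "norm (kernel_term T k v) \<le> sqrt (norm (gram (word_op T) (words k))) * norm v"
    unfolding M_def by (rule power2_le_imp_le) simp
qed simp

section \<open>The homogeneous parts of the power series at T\<close>

definition calculus_term :: "('n list \<Rightarrow> complex) \<Rightarrow> nat \<Rightarrow> 'h \<Rightarrow>\<^sub>L 'h" where
  "calculus_term a k = (\<Sum>\<alpha>\<in>words k. scaleC_blinfun (a \<alpha>) (word_op T \<alpha>))"

lemma free_eval_eq: "free_eval a T = suminf (calculus_term a)"
  by (simp add: free_eval_def calculus_term_def[abs_def])

lemma clinear_calculus_term: "clinear (calculus_term a k)"
proof -
  have "clinear (\<lambda>x. \<Sum>\<alpha>\<in>words k. a \<alpha> *\<^sub>C word_op T \<alpha> x)"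
    by (intro clinear_sum clinear_scaleC_op clinear_word)
  then show ?thesis
    by (simp add: calculus_term_def blinfun.sum_left scaleC_blinfun.rep_eq clinear_def)
qed

lemma norm_calculus_term_le:
  "norm (calculus_term a k)
    \<le> sqrt (\<Sum>\<alpha>\<in>words k. (cmod (a \<alpha>))\<^sup>2) * sqrt (norm (gram (word_op T) (words k)))"
  unfolding calculus_term_def by (rule norm_row_le[OF clinear_word])

context
  assumes radius: "joint_spectral_radius T < 1"
begin

lemma cauchy_kernel_sums:
  "(\<lambda>k. \<Sum>\<alpha>\<in>words k. tensor (fock_basis \<alpha>) (cadjoint (word_op T \<alpha>) y))
    sums cauchy_kernel T (tensor (fock_basis []) y)"
proof -
  have "summable (kernel_term T)"
    by (rule summable_comparison_test'[OF joint_spectral_radius_summable[OF lin radius]])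
      (rule norm_kernel_term_le)
  then have "kernel_term T sums cauchy_kernel T"
    by (simp add: cauchy_kernel_def kernel_term_def[abs_def] summable_sums)
  from bounded_linear.sums[OF blinfun.bounded_linear_left this, of "tensor (fock_basis []) y"]
  show ?thesis by (simp add: kernel_term_tensor)
qed

context
  fixes a :: "'n list \<Rightarrow> complex" and N :: real
  assumes N: "N \<ge> 0" and bound: "\<And>k. (\<Sum>\<alpha>\<in>words k. (cmod (a \<alpha>))\<^sup>2) \<le> N\<^sup>2"
begin

text \<open>Of f, only a bound on its homogeneous coefficient blocks enters here; N will be the
  H-infinity norm. As N is the same in every degree, summability comes from the row norms.\<close>

lemma norm_calculus_term_le':
  "norm (calculus_term a k) \<le> sqrt (norm (gram (word_op T) (words k))) * N"
proof -
  have "sqrt (\<Sum>\<alpha>\<in>words k. (cmod (a \<alpha>))\<^sup>2) \<le> N"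
    using N bound by (simp add: real_le_lsqrt sum_nonneg)
  then have "sqrt (\<Sum>\<alpha>\<in>words k. (cmod (a \<alpha>))\<^sup>2) * sqrt (norm (gram (word_op T) (words k)))
    \<le> N * sqrt (norm (gram (word_op T) (words k)))"
    by (rule mult_right_mono) simp
  then show ?thesis using norm_calculus_term_le[of a k] by (simp add: mult.commute)
qed

lemma calculus_summable: "summable (calculus_term a)"
  by (rule summable_comparison_test'[OF
        summable_mult2[OF joint_spectral_radius_summable[OF lin radius]]])
    (rule norm_calculus_term_le')

lemma norm_free_eval_le:
  "norm (free_eval a T) \<le> (\<Sum>k. sqrt (norm (gram (word_op T) (words k)))) * N"
proof -
  have sum: "summable (\<lambda>k. sqrt (norm (gram (word_op T) (words k))) * N)"
    by (rule summable_mult2[OF joint_spectral_radius_summable[OF lin radius]])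
  have "norm (free_eval a T) \<le> (\<Sum>k. sqrt (norm (gram (word_op T) (words k))) * N)"
    unfolding free_eval_eq by (rule norm_suminf_le[OF norm_calculus_term_le' sum])
  then show ?thesis
    by (simp add: suminf_mult2[OF joint_spectral_radius_summable[OF lin radius]])
qed

text \<open>The pairing involves F only through its value on the vacuum vector, so the coefficients
  of F 1 suffice. The identity is proved in weak form, which also yields uniqueness in the
  description of the transform.\<close>

lemma cauchy_transform_eq_free_eval:
  fixes F :: "'n fock \<Rightarrow>\<^sub>L 'n fock"
  assumes F: "clinear F" "\<And>\<alpha>. Rep_ell2 (F (fock_basis [])) \<alpha> = a \<alpha>"
  shows "cauchy_transform T F = free_eval a T"
  unfolding cauchy_transform_def
proof (rule the_equality)
  have key: "cinner (free_eval a T x) y =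
      cinner (tensor_op F id_blinfun (tensor (fock_basis []) x))
        (cauchy_kernel T (tensor (fock_basis []) y))" for x y
  proof (rule sums_unique2)
    have "calculus_term a sums free_eval a T"
      unfolding free_eval_eq by (rule summable_sums[OF calculus_summable])
    then show "(\<lambda>k. cinner (calculus_term a k x) y) sums cinner (free_eval a T x) y"
      by (intro bounded_linear.sums[OF bounded_linear_cinner_left]
          bounded_linear.sums[OF blinfun.bounded_linear_left])
    have "clinear (id_blinfun :: 'h \<Rightarrow>\<^sub>L 'h)" by (simp add: clinear_def)
    then have "tensor_op F id_blinfun (tensor (fock_basis []) x) = tensor (F (fock_basis [])) x"
      by (simp add: tensor_op_tensor[OF F(1)] del: blinfun_apply_id_blinfun) simp
    \<comment> \<open>Pairing F 1 with e_\<alpha> reads off the coefficient at \<alpha>, and the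
      adjoint moves back to x as the word operator.\<close>
    moreover have "cinner (calculus_term a k x) y =
      cinner (tensor (F (fock_basis [])) x)
        (\<Sum>\<alpha>\<in>words k. tensor (fock_basis \<alpha>) (cadjoint (word_op T \<alpha>) y))" for k
      by (simp add: calculus_term_def blinfun.sum_left scaleC_blinfun.rep_eq cinner_sum_left
          cinner_sum_right cinner_scaleC_left cinner_tensor cinner_fock_basis_right F(2)
          cinner_cadjoint[OF clinear_word])
    ultimately show "(\<lambda>k. cinner (calculus_term a k x) y) sums
      cinner (tensor_op F id_blinfun (tensor (fock_basis []) x))
        (cauchy_kernel T (tensor (fock_basis []) y))"
      using bounded_linear.sums[OF bounded_linear_cinner_right cauchy_kernel_sums] by simp
  qed
  have "clinear (free_eval a T)"
    unfolding free_eval_eq by (rule clinear_suminf[OF calculus_summable clinear_calculus_term])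
  then show "clinear (free_eval a T) \<and> (\<forall>x y. cinner (free_eval a T x) y =
      cinner (tensor_op F id_blinfun (tensor (fock_basis []) x))
        (cauchy_kernel T (tensor (fock_basis []) y)))"
    using key by blast
  fix B :: "'h \<Rightarrow>\<^sub>L 'h"
  assume "clinear B \<and> (\<forall>x y. cinner (B x) y =
      cinner (tensor_op F id_blinfun (tensor (fock_basis []) x))
        (cauchy_kernel T (tensor (fock_basis []) y)))"
  then have "cinner (B x) y = cinner (free_eval a T x) y" for x y by (simp add: key)
  then show "B = free_eval a T" by (rule blinfun_eqI[OF cinner_eqI])
qed

end

end

end

section \<open>Transport of a Hilbert space to a structure\<close>

text \<open>Here f is known only through the growth condition of \<open>free_hol\<close>, which lets
  the coefficient blocks grow like b^k for every b > 1. The row norms are at most a constant times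
  s^k with s < 1, which wins once b s < 1.\<close>

lemma strict_gram_summable:
  fixes T :: "'n :: finite \<Rightarrow> 'h :: chilbert_space \<Rightarrow>\<^sub>L 'h"
  assumes lin: "\<And>i. clinear (T i)" and contr: "norm (gram T UNIV) < 1" and a: "a \<in> free_hol"
  shows "summable (calculus_term T a)"
proof -
  define c where "c k = norm (gram (word_op T) (words k))" for k
  define q where "q = norm (gram T UNIV)"
  have "gram (word_op T) (words 1) = (\<Sum>i\<in>UNIV. word_op T [i] o\<^sub>L cadjoint (word_op T [i]))"
    unfolding gram_def
    by (rule sum.reindex_bij_witness[of _ "\<lambda>i. [i]" hd]) (auto simp: words_def length_Suc_conv)
  moreover have "word_op T [i] = T i" for i by (rule blinfun_eqI) simp
  ultimately have c1: "c 1 = q" by (simp add: c_def q_def gram_def)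
  \<comment> \<open>\<open>c 0\<close>, the norm of the identity, is kept as a factor; it is 1
    except on the zero space.\<close>
  have c: "c k \<le> c 0 * q ^ k" for k
  proof (induction k)
    case (Suc k)
    have "c (1 + k) \<le> c 1 * c k"
      unfolding c_def by (rule gram_words_submultiplicative[OF lin])
    also have "\<dots> \<le> q * (c 0 * q ^ k)"
      unfolding c1 by (rule mult_left_mono[OF Suc.IH]) (simp add: q_def)
    finally show ?case by (simp add: mult_ac)
  qed simp
  define A where "A k = (\<Sum>\<alpha>\<in>words k. (cmod (a \<alpha>))\<^sup>2)" for k
  have A: "A k \<ge> 0" for k by (simp add: A_def sum_nonneg)
  define s where "s = sqrt q"
  have s: "s \<ge> 0" "s < 1" using contr by (simp_all add: s_def q_def)
  \<comment> \<open>Any b > 1 with b s < 1 would do; this choice also covers s = 0.\<close>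
  define b where "b = 2 / (1 + s)"
  have b: "b > 1" "b * s < 1" using s by (simp_all add: b_def)
  have "limsup (\<lambda>k. ereal (root (2 * k) (A k))) < ereal b"
    using a b(1) by (auto simp: free_hol_def A_def intro: le_less_trans)
  then have "\<forall>\<^sub>F k in sequentially. ereal (root (2 * k) (A k)) < ereal b"
    by (rule Limsup_lessD)
  then have "\<forall>\<^sub>F k in sequentially. root k (sqrt (A k) * s ^ k) \<le> b * s"
    using eventually_gt_at_top[of 0]
  proof eventually_elim
    case (elim k)
    have "root k (sqrt (A k)) = root (2 * k) (A k)"
      unfolding sqrt_def by (metis mult.commute real_root_mult_exp)
    then have "root k (sqrt (A k) * s ^ k) = root (2 * k) (A k) * s"
      using elim s by (simp add: real_root_mult real_root_power_cancel)
    also have "\<dots> \<le> b * s" using elim s by (intro mult_right_mono) auto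
    finally show ?case .
  qed
  then have "summable (\<lambda>k. sqrt (A k) * s ^ k)"
    using A s b by (intro summable_of_root_less[of _ "b * s"]) auto
  then have "summable (\<lambda>k. sqrt (A k) * s ^ k * sqrt (c 0))" by (rule summable_mult2)
  then show ?thesis
  proof (rule summable_comparison_test')
    fix k
    have "norm (calculus_term T a k) \<le> sqrt (A k) * sqrt (c k)"
      unfolding A_def c_def by (rule norm_calculus_term_le[OF lin])
    also have "sqrt (c k) \<le> sqrt (c 0 * q ^ k)" using c by simp
    also have "\<dots> = s ^ k * sqrt (c 0)" by (simp add: s_def real_sqrt_mult real_sqrt_power)
    finally show "norm (calculus_term T a k) \<le> sqrt (A k) * s ^ k * sqrt (c 0)"
      using A by (simp add: mult_left_mono mult.assoc)
  qed
qed

text \<open>Bridge between two encodings: Hilbert spaces as types, where Fock space lives, and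
  Hilbert spaces as structures, over which \<open>hinf_norm\<close> takes its supremum.\<close>

definition transport :: "('k :: chilbert_space \<Rightarrow> 'v) \<Rightarrow> 'v inner_product_structure" where
  "transport \<phi> = \<lparr>carrier = range \<phi>, monoid.mult = (\<lambda>_ _. \<phi> 0), one = \<phi> 0, ring.zero = \<phi> 0,
    add = (\<lambda>x y. \<phi> (the_inv \<phi> x + the_inv \<phi> y)), smult = (\<lambda>c x. \<phi> (c *\<^sub>C the_inv \<phi> x)),
    ip = (\<lambda>x y. cinner (the_inv \<phi> x) (the_inv \<phi> y))\<rparr>"

lemma cring_complex_ring: "cring complex_ring"
proof (rule cringI)
  show "abelian_group complex_ring"
    by (rule abelian_groupI)
      (auto simp: complex_ring_def add.assoc intro: exI[of _ "- x" for x] ab_left_minus)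
  show "comm_monoid complex_ring"
    by (rule comm_monoidI) (auto simp: complex_ring_def)
qed (auto simp: complex_ring_def distrib_right)

context
  fixes \<phi> :: "'k :: chilbert_space \<Rightarrow> 'v"
  assumes inj: "inj \<phi>"
begin

lemma transport_simps:
  "carrier (transport \<phi>) = range \<phi>"
  "\<zero>\<^bsub>transport \<phi>\<^esub> = \<phi> 0"
  "\<phi> x \<oplus>\<^bsub>transport \<phi>\<^esub> \<phi> y = \<phi> (x + y)"
  "c \<odot>\<^bsub>transport \<phi>\<^esub> \<phi> x = \<phi> (c *\<^sub>C x)"
  "ip (transport \<phi>) (\<phi> x) (\<phi> y) = cinner x y"
  "ip_norm (transport \<phi>) (\<phi> x) = norm x"
  using inj by (simp_all add: transport_def ip_norm_def cinner_self the_inv_f_f)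

lemma abelian_group_transport: "abelian_group (transport \<phi>)"
proof (rule abelian_groupI)
  fix v assume "v \<in> carrier (transport \<phi>)"
  then obtain x where "v = \<phi> x" by (auto simp: transport_simps)
  then have "\<phi> (- x) \<oplus>\<^bsub>transport \<phi>\<^esub> v = \<zero>\<^bsub>transport \<phi>\<^esub>" by (simp add: transport_simps)
  then show "\<exists>w\<in>carrier (transport \<phi>). w \<oplus>\<^bsub>transport \<phi>\<^esub> v = \<zero>\<^bsub>transport \<phi>\<^esub>" by (auto simp: transport_simps)
qed (auto simp: transport_simps add_ac)

interpretation abelian_group "transport \<phi>" by (rule abelian_group_transport)

lemma transport_minus: "\<phi> x \<ominus>\<^bsub>transport \<phi>\<^esub> \<phi> y = \<phi> (x - y)"
proof -
  have "\<ominus>\<^bsub>transport \<phi>\<^esub> \<phi> y = \<phi> (- y)"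
    by (rule minus_equality) (auto simp: transport_simps)
  then show ?thesis by (simp add: a_minus_def transport_simps)
qed

lemma transport_finsum:
  assumes "finite A" "\<And>i. i \<in> A \<Longrightarrow> g i = \<phi> (f i)"
  shows "finsum (transport \<phi>) g A = \<phi> (\<Sum>i\<in>A. f i)"
  using assms
proof (induction A rule: finite_induct)
  case (insert i A)
  have "finsum (transport \<phi>) g (insert i A) = g i \<oplus>\<^bsub>transport \<phi>\<^esub> finsum (transport \<phi>) g A"
    using insert by (intro finsum_insert) (auto simp: transport_simps)
  then show ?case using insert by (simp add: transport_simps)
qed (simp add: transport_simps)

lemma hilbert_structure_transport: "hilbert_structure (transport \<phi>)"
proof (intro hilbert_structure.intro hilbert_structure_axioms.intro)
  show "Module.module complex_ring (transport \<phi>)"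
  proof (rule moduleI[OF cring_complex_ring abelian_group_transport])
  qed (auto simp: transport_simps complex_ring_def scaleC_add_left scaleC_add_right scaleC_scaleC
      scaleC_one)
  fix x y z c assume "x \<in> carrier (transport \<phi>)" "y \<in> carrier (transport \<phi>)" "z \<in> carrier (transport \<phi>)"
  then show "ip (transport \<phi>) (x \<oplus>\<^bsub>transport \<phi>\<^esub> y) z = ip (transport \<phi>) x z + ip (transport \<phi>) y z"
    by (auto simp: transport_simps cinner_add_left)
next
  fix x y c assume "x \<in> carrier (transport \<phi>)" "y \<in> carrier (transport \<phi>)"
  then show "ip (transport \<phi>) (c \<odot>\<^bsub>transport \<phi>\<^esub> x) y = c * ip (transport \<phi>) x y"
    by (auto simp: transport_simps cinner_scaleC_left)
next
  fix x y assume "x \<in> carrier (transport \<phi>)" "y \<in> carrier (transport \<phi>)"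
  then show "ip (transport \<phi>) x y = cnj (ip (transport \<phi>) y x)"
    by (auto simp: transport_simps intro: cinner_commute)
next
  fix x assume "x \<in> carrier (transport \<phi>)" "x \<noteq> \<zero>\<^bsub>transport \<phi>\<^esub>"
  then show "Re (ip (transport \<phi>) x x) > 0"
    by (auto simp: transport_simps cinner_self)
next
  fix s :: "nat \<Rightarrow> 'v"
  assume s: "range s \<subseteq> carrier (transport \<phi>)"
    and cauchy: "\<And>e. e > 0 \<Longrightarrow> \<exists>N. \<forall>m\<ge>N. \<forall>k\<ge>N. ip_norm (transport \<phi>) (s m \<ominus>\<^bsub>transport \<phi>\<^esub> s k) < e"
  have "\<exists>x. s m = \<phi> x" for m using s by (auto simp: transport_simps)
  then obtain t where t: "\<And>m. s m = \<phi> (t m)" by metis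
  have "Cauchy t"
    using cauchy by (intro metric_CauchyI) (simp add: t transport_minus transport_simps dist_norm)
  then obtain l where "t \<longlonglongrightarrow> l" using Cauchy_convergent convergent_def by blast
  then have "(\<lambda>m. ip_norm (transport \<phi>) (s m \<ominus>\<^bsub>transport \<phi>\<^esub> \<phi> l)) \<longlonglongrightarrow> 0"
    by (simp add: t transport_minus transport_simps tendsto_norm_zero LIM_zero)
  then show "\<exists>l\<in>carrier (transport \<phi>). (\<lambda>m. ip_norm (transport \<phi>) (s m \<ominus>\<^bsub>transport \<phi>\<^esub> l)) \<longlonglongrightarrow> 0"
    by (auto simp: transport_simps)
qed

lemma transport_struct_ops:
  fixes A :: "'k \<Rightarrow>\<^sub>L 'k"
  assumes "clinear A" "\<And>x. g (\<phi> x) = \<phi> (A x)"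
  shows "g \<in> struct_ops (transport \<phi>)"
proof -
  have "\<exists>M. \<forall>v\<in>carrier (transport \<phi>). ip_norm (transport \<phi>) (g v) \<le> M * ip_norm (transport \<phi>) v"
    by (rule exI[of _ "norm A"]) (auto simp: transport_simps assms(2) norm_blinfun)
  then show ?thesis
    by (auto simp: struct_ops_def transport_simps assms(2) clinear_add[OF assms(1)]
        clinear_scaleC[OF assms(1)])
qed

lemma transport_opnorm:
  fixes A :: "'k \<Rightarrow>\<^sub>L 'k"
  assumes g: "\<And>x. g (\<phi> x) = \<phi> (A x)"
  shows "struct_opnorm (transport \<phi>) g = norm A"
proof -
  have set: "{ip_norm (transport \<phi>) (g v) |v. v \<in> carrier (transport \<phi>) \<and> ip_norm (transport \<phi>) v \<le> 1} = {norm (A x) |x. norm x \<le> 1}"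
    by (auto simp: transport_simps g) (metis g rangeI transport_simps(6))
  have upper: "norm (A x) \<le> norm A" if "norm x \<le> 1" for x
    using norm_blinfun[of A x] mult_left_le[OF that, of "norm A"] by simp
  then have bdd: "bdd_above {norm (A x) |x. norm x \<le> 1}" by (auto intro!: bdd_aboveI)
  have "norm A \<le> Sup {norm (A x) |x. norm x \<le> 1}"
  proof (rule norm_blinfun_bound)
    \<comment> \<open>The point 0 shows the supremum to be nonnegative, even on the zero space,
      which has no unit vectors.\<close>
    have "norm (A 0) \<le> Sup {norm (A x) |x. norm x \<le> 1}"
      by (rule cSup_upper[OF _ bdd]) (auto intro!: exI[of _ 0])
    then show "0 \<le> Sup {norm (A x) |x. norm x \<le> 1}" by simp
    fix x
    show "norm (A x) \<le> Sup {norm (A x) |x. norm x \<le> 1} * norm x"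
    proof (cases "x = 0")
      case False
      have "norm (A (sgn x)) \<le> Sup {norm (A x) |x. norm x \<le> 1}"
        by (rule cSup_upper[OF _ bdd]) (auto simp: norm_sgn)
      moreover have "norm (A (sgn x)) = norm (A x) / norm x"
        by (simp add: sgn_div_norm blinfun.scaleR_right divide_inverse mult.commute)
      ultimately show ?thesis using False by (simp add: field_simps)
    qed simp
  qed
  moreover have "Sup {norm (A x) |x. norm x \<le> 1} \<le> norm A"
    by (rule cSup_least) (use upper in \<open>auto intro: exI[of _ 0]\<close>)
  ultimately show ?thesis by (simp add: struct_opnorm_def set)
qed

text \<open>\<open>struct_adjoint\<close> is an arbitrary choice whose values off the carrier are
  undetermined, so it can be identified only at points \<phi> x. There the adjoint relation fixes
  all inner products and hence the value.\<close>

lemma transport_adjoint: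
  fixes A :: "'k \<Rightarrow>\<^sub>L 'k"
  assumes lin: "clinear A" and g: "\<And>x. g (\<phi> x) = \<phi> (A x)"
  shows "struct_adjoint (transport \<phi>) g (\<phi> x) = \<phi> (cadjoint A x)"
proof -
  define is_adj where
    "is_adj B \<longleftrightarrow> B \<in> struct_ops (transport \<phi>) \<and> (\<forall>x\<in>carrier (transport \<phi>). \<forall>y\<in>carrier (transport \<phi>). ip (transport \<phi>) (g x) y = ip (transport \<phi>) x (B y))" for B
  define B where "B = (\<lambda>v. \<phi> (cadjoint A (the_inv \<phi> v)))"
  have B: "B (\<phi> x) = \<phi> (cadjoint A x)" for x using inj by (simp add: B_def the_inv_f_f)
  have "is_adj B"
    using transport_struct_ops[OF clinear_cadjoint[OF lin] B]
    by (auto simp: is_adj_def transport_simps g B cinner_cadjoint[OF lin])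
  moreover have "struct_adjoint (transport \<phi>) g = (SOME B. is_adj B)"
    by (simp add: struct_adjoint_def is_adj_def)
  ultimately have adj: "is_adj (struct_adjoint (transport \<phi>) g)"
    by (metis someI)
  then have "struct_adjoint (transport \<phi>) g (\<phi> x) \<in> carrier (transport \<phi>)"
    unfolding is_adj_def struct_ops_def by (auto simp: transport_simps)
  then obtain z where z: "struct_adjoint (transport \<phi>) g (\<phi> x) = \<phi> z" by (auto simp: transport_simps)
  have "cinner y z = cinner y (cadjoint A x)" for y
  proof -
    have "ip (transport \<phi>) (g (\<phi> y)) (\<phi> x) = ip (transport \<phi>) (\<phi> y) (\<phi> z)"
      using adj z by (auto simp: is_adj_def transport_simps(1))
    then show ?thesis by (simp add: transport_simps g cinner_cadjoint[OF lin])
  qed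
  then show ?thesis using z cinner_eqI_right[of z "cadjoint A x"] by simp
qed

text \<open>Conjugation by \<phi> respects words, finite sums and adjoints on the image and
  preserves operator norms. So contractivity and norm convergence of the series carry over, and f(T)
  competes in the supremum.\<close>

lemma norm_free_eval_hinf_values:
  fixes T :: "'n :: finite \<Rightarrow> 'k \<Rightarrow>\<^sub>L 'k"
  assumes lin: "\<And>i. clinear (T i)" and contr: "norm (gram T UNIV) < 1" and a: "a \<in> free_hol"
  shows "norm (free_eval a T) \<in> hinf_values TYPE('v) a"
proof -
  define X where "X i v = \<phi> (T i (the_inv \<phi> v))" for i v
  define F where "F v = \<phi> (free_eval a T (the_inv \<phi> v))" for v
  have X: "X i (\<phi> x) = \<phi> (T i x)" for i x using inj by (simp add: X_def the_inv_f_f)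
  have F: "F (\<phi> x) = \<phi> (free_eval a T x)" for x using inj by (simp add: F_def the_inv_f_f)
  have sum: "summable (calculus_term T a)" by (rule strict_gram_summable[OF assms])
  have lin_eval: "clinear (free_eval a T)"
    unfolding free_eval_eq[OF lin] by (rule clinear_suminf[OF sum clinear_calculus_term[OF lin]])
  have "struct_opnorm (transport \<phi>) (\<lambda>v. finsum (transport \<phi>) (\<lambda>i. X i (struct_adjoint (transport \<phi>) (X i) v)) UNIV) = norm (gram T UNIV)"
    by (rule transport_opnorm)
      (simp add: transport_finsum[OF finite] transport_adjoint[OF lin X] X gram_def blinfun.sum_left)
  then have row: "strict_row_contraction (transport \<phi>) X"
    using contr transport_struct_ops[OF lin X] by (simp add: strict_row_contraction_def)
  have word: "struct_word X \<alpha> (\<phi> x) = \<phi> (word_op T \<alpha> x)" for \<alpha> x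
    by (induction \<alpha>) (simp_all add: X)
  have "struct_opnorm (transport \<phi>) (\<lambda>v. finsum (transport \<phi>) (\<lambda>k. finsum (transport \<phi>) (\<lambda>\<alpha>. a \<alpha> \<odot>\<^bsub>transport \<phi>\<^esub> struct_word X \<alpha> v) (words k)) {..<N}
      \<ominus>\<^bsub>transport \<phi>\<^esub> F v) = norm ((\<Sum>k<N. calculus_term T a k) - free_eval a T)" for N
  proof (rule transport_opnorm)
    fix x
    have "finsum (transport \<phi>) (\<lambda>\<alpha>. a \<alpha> \<odot>\<^bsub>transport \<phi>\<^esub> struct_word X \<alpha> (\<phi> x)) (words k) = \<phi> (calculus_term T a k x)" for k
      by (simp add: transport_finsum[where f = "\<lambda>\<alpha>. a \<alpha> *\<^sub>C word_op T \<alpha> x"] word transport_simps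
          calculus_term_def[OF lin] blinfun.sum_left scaleC_blinfun.rep_eq)
    then have "finsum (transport \<phi>) (\<lambda>k. finsum (transport \<phi>) (\<lambda>\<alpha>. a \<alpha> \<odot>\<^bsub>transport \<phi>\<^esub> struct_word X \<alpha> (\<phi> x)) (words k)) {..<N}
      = \<phi> (\<Sum>k<N. calculus_term T a k x)"
      by (intro transport_finsum) simp_all
    then show "finsum (transport \<phi>) (\<lambda>k. finsum (transport \<phi>) (\<lambda>\<alpha>. a \<alpha> \<odot>\<^bsub>transport \<phi>\<^esub> struct_word X \<alpha> (\<phi> x)) (words k)) {..<N}
      \<ominus>\<^bsub>transport \<phi>\<^esub> F (\<phi> x) = \<phi> (((\<Sum>k<N. calculus_term T a k) - free_eval a T) x)"
      by (simp add: F transport_minus blinfun.sum_left blinfun.diff_left)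
  qed
  moreover have "(\<lambda>N. norm ((\<Sum>k<N. calculus_term T a k) - free_eval a T)) \<longlonglongrightarrow> 0"
    using summable_LIMSEQ[OF sum] by (simp add: free_eval_eq[OF lin] tendsto_norm_zero LIM_zero)
  ultimately have "struct_eval a (transport \<phi>) X F"
    using transport_struct_ops[OF lin_eval F] by (simp add: struct_eval_def)
  moreover have "struct_opnorm (transport \<phi>) F = norm (free_eval a T)"
    by (rule transport_opnorm[OF F])
  ultimately show ?thesis
    unfolding hinf_values_def using hilbert_structure_transport row by force
qed

lemma norm_free_eval_le_hinf_norm:
  fixes T :: "'n :: finite \<Rightarrow> 'k \<Rightarrow>\<^sub>L 'k"
  assumes lin: "\<And>i. clinear (T i)" and contr: "norm (gram T UNIV) < 1" and a: "a \<in> hinf TYPE('v)"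
  shows "norm (free_eval a T) \<le> hinf_norm TYPE('v) a"
  unfolding hinf_norm_def using a
  by (intro cSup_upper norm_free_eval_hinf_values[OF lin contr]) (auto simp: hinf_def)

end

section \<open>Boundary functions\<close>

definition left_shift :: "'n \<Rightarrow> ('n list \<Rightarrow> complex) \<Rightarrow> 'n list \<Rightarrow> complex" where
  "left_shift i \<xi> \<gamma> = (if \<gamma> \<noteq> [] \<and> hd \<gamma> = i then \<xi> (tl \<gamma>) else 0)"

lemma left_shift_has_sum:
  assumes "((\<lambda>\<beta>. (cmod (\<xi> \<beta>))\<^sup>2) has_sum s) UNIV"
  shows "((\<lambda>\<gamma>. (cmod (left_shift i \<xi> \<gamma>))\<^sup>2) has_sum s) UNIV"
proof -
  have "((\<lambda>\<gamma>. (cmod (left_shift i \<xi> \<gamma>))\<^sup>2) has_sum s) (range ((#) i))"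
    using assms by (subst has_sum_reindex) (simp_all add: o_def left_shift_def)
  moreover have "\<gamma> \<in> range ((#) i)" if "\<gamma> \<noteq> []" "hd \<gamma> = i" for \<gamma>
    using that by (cases \<gamma>) auto
  ultimately show ?thesis
    by (subst has_sum_cong_neutral[where T = "range ((#) i)"]) (auto simp: left_shift_def)
qed

lift_definition left_creation_vec :: "'n \<Rightarrow> 'n fock \<Rightarrow> 'n fock" is left_shift
  using left_shift_has_sum by (fastforce simp: summable_on_def)

lemma norm_left_creation_vec: "norm (left_creation_vec i \<xi>) = norm \<xi>"
proof -
  have "(norm (left_creation_vec i \<xi>))\<^sup>2 = (norm \<xi>)\<^sup>2"
    unfolding ell2_norm_sq left_creation_vec.rep_eq
    using has_sum_infsum[OF Rep_ell2_summable] by (intro infsumI left_shift_has_sum)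
  then show ?thesis by (simp add: power2_eq_iff_nonneg)
qed

lift_definition left_creation :: "'n \<Rightarrow> 'n fock \<Rightarrow>\<^sub>L 'n fock" is left_creation_vec
proof (rule bounded_linear_intro[where K = 1])
  fix i :: 'n and \<xi> \<eta> :: "'n fock" and r :: real
  show "left_creation_vec i (\<xi> + \<eta>) = left_creation_vec i \<xi> + left_creation_vec i \<eta>"
    by transfer (auto simp: left_shift_def fun_eq_iff)
  show "left_creation_vec i (r *\<^sub>R \<xi>) = r *\<^sub>R left_creation_vec i \<xi>"
    by transfer (auto simp: left_shift_def fun_eq_iff)
qed (simp add: norm_left_creation_vec)

lemma Rep_left_creation: "Rep_ell2 (left_creation i \<xi>) = left_shift i (Rep_ell2 \<xi>)"
  by (simp add: left_creation.rep_eq left_creation_vec.rep_eq)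

lemma norm_left_creation: "norm (left_creation i \<xi>) = norm \<xi>"
  by (simp add: left_creation.rep_eq norm_left_creation_vec)

lemma cinner_left_creation: "i \<noteq> j \<Longrightarrow> cinner (left_creation i \<xi>) (left_creation j \<eta>) = 0"
  by (simp add: cinner_ell2.rep_eq Rep_left_creation left_shift_def infsum_0 cinner_complex_def)

lemma clinear_left_creation: "clinear (left_creation i)"
  unfolding clinear_def
proof (intro conjI allI)
  fix \<xi> \<eta> :: "'a fock" and c
  show "left_creation i (\<xi> + \<eta>) = left_creation i \<xi> + left_creation i \<eta>"
    by (rule blinfun.add_right)
  show "left_creation i (c *\<^sub>C \<xi>) = c *\<^sub>C left_creation i \<xi>"
    by (rule ell2_eqI) (simp add: Rep_left_creation scaleC_ell2.rep_eq left_shift_def scaleC_complex_def)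
qed

definition scaled_creation :: "real \<Rightarrow> 'n \<Rightarrow> 'n fock \<Rightarrow>\<^sub>L 'n fock" where
  "scaled_creation r i = scaleC_blinfun (complex_of_real r) (left_creation i)"

lemma clinear_scaled_creation: "clinear (scaled_creation r i)"
  using clinear_scaleC_op[OF clinear_left_creation]
  by (simp add: scaled_creation_def scaleC_blinfun.rep_eq clinear_def)

text \<open>The condition says that \<alpha> is a prefix of \<gamma>; for a shorter \<gamma>,
  \<open>take\<close> returns \<gamma> itself, which cannot equal \<alpha>.\<close>

lemma Rep_word_scaled_creation:
  "Rep_ell2 (word_op (scaled_creation r) \<alpha> \<xi>) \<gamma> =
    (if take (length \<alpha>) \<gamma> = \<alpha> then complex_of_real r ^ length \<alpha> * Rep_ell2 \<xi> (drop (length \<alpha>) \<gamma>) else 0)"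
proof (induction \<alpha> arbitrary: \<gamma>)
  case (Cons i \<alpha>)
  then show ?case
    by (cases \<gamma>) (auto simp: scaled_creation_def scaleC_blinfun.rep_eq scaleC_ell2.rep_eq
        scaleC_complex_def Rep_left_creation left_shift_def)
qed simp

text \<open>No formula for the adjoints is used. The S_i are isometries with orthogonal ranges, so
  the row r S multiplies the norm of a column by exactly r. Applied to the column of adjoints of y,
  of norm s, and paired with y, this gives s^2 at most r s times norm y.\<close>

lemma norm_gram_scaled_creation:
  fixes r :: real
  assumes r: "0 \<le> r"
  shows "norm (gram (scaled_creation r :: 'n :: finite \<Rightarrow> _) UNIV) \<le> r\<^sup>2"
proof (rule norm_gram_le)
  fix y :: "'n fock"
  define x where "x i = cadjoint (scaled_creation r i) y" for i :: 'n
  define s where "s = sqrt (\<Sum>i\<in>UNIV. (norm (x i))\<^sup>2)"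
  have s2: "s\<^sup>2 = (\<Sum>i\<in>UNIV. (norm (x i))\<^sup>2)" by (simp add: s_def sum_nonneg)
  define z where "z = (\<Sum>i\<in>UNIV. scaled_creation r i (x i))"
  have "(norm z)\<^sup>2 = (\<Sum>i\<in>UNIV. (norm (scaled_creation r i (x i)))\<^sup>2)"
    unfolding z_def
    by (intro norm_sum_Pythagorean pairwiseI cinner_eq_0_orthogonal)
      (auto simp: scaled_creation_def scaleC_blinfun.rep_eq cinner_scaleC_left cinner_scaleC_right
        cinner_left_creation)
  also have "\<dots> = (r * s)\<^sup>2"
    by (simp add: scaled_creation_def scaleC_blinfun.rep_eq norm_scaleC norm_left_creation
        power_mult_distrib s2 sum_distrib_left)
  finally have z: "norm z = r * s"
    using r by (simp add: power2_eq_iff_nonneg s_def sum_nonneg)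
  have "cinner z y = complex_of_real (s\<^sup>2)"
    unfolding z_def s2
    by (simp add: cinner_sum_left cinner_cadjoint[OF clinear_scaled_creation] x_def[symmetric] cinner_self)
  then have "s\<^sup>2 \<le> norm z * norm y"
    using norm_cinner_le[of z y] by (simp add: norm_power)
  then have "s\<^sup>2 \<le> r * norm y * s" by (simp add: z mult_ac)
  then have "s \<le> r * norm y"
    using norm_le_of_square_le[of s "r * norm y"] r by (simp add: s_def sum_nonneg)
  then have "s\<^sup>2 \<le> (r * norm y)\<^sup>2" by (rule power_mono) (simp add: s_def sum_nonneg)
  then show "(\<Sum>i\<in>UNIV. (norm (cadjoint (scaled_creation r i) y))\<^sup>2) \<le> r\<^sup>2 * (norm y)\<^sup>2"
    by (simp add: s2 x_def power_mult_distrib)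
qed (simp_all add: clinear_scaled_creation)

text \<open>Coefficient at \<gamma> of the formal product of the power series with \<xi>. A word has
  finitely many splittings, so left multiplication by f makes sense coordinatewise before anything
  is known about boundedness.\<close>

definition convolution :: "('n list \<Rightarrow> complex) \<Rightarrow> ('n list \<Rightarrow> complex) \<Rightarrow> 'n list \<Rightarrow> complex" where
  "convolution a \<xi> \<gamma> = (\<Sum>m\<le>length \<gamma>. a (take m \<gamma>) * \<xi> (drop m \<gamma>))"

lemma Rep_free_eval_scaled_creation:
  fixes a :: "'n :: finite list \<Rightarrow> complex"
  assumes sum: "summable (calculus_term (scaled_creation r) a)"
  shows "Rep_ell2 (free_eval a (scaled_creation r) \<xi>) \<gamma>
    = convolution (\<lambda>\<alpha>. complex_of_real r ^ length \<alpha> * a \<alpha>) (Rep_ell2 \<xi>) \<gamma>"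
proof -
  note lin = clinear_scaled_creation
  define g where "g k = (if k \<le> length \<gamma>
    then complex_of_real r ^ k * a (take k \<gamma>) * Rep_ell2 \<xi> (drop k \<gamma>) else 0)" for k
  have "Rep_ell2 (calculus_term (scaled_creation r) a k \<xi>) \<gamma> = g k" for k
  proof -
    have "Rep_ell2 (calculus_term (scaled_creation r) a k \<xi>) \<gamma>
      = (\<Sum>\<alpha>\<in>words k. a \<alpha> * Rep_ell2 (word_op (scaled_creation r) \<alpha> \<xi>) \<gamma>)"
      by (simp add: calculus_term_def[OF lin] blinfun.sum_left scaleC_blinfun.rep_eq Rep_ell2_sum
          scaleC_ell2.rep_eq scaleC_complex_def)
    also have "\<dots> = (\<Sum>\<alpha>\<in>words k. if \<alpha> = take k \<gamma>
        then complex_of_real r ^ k * a (take k \<gamma>) * Rep_ell2 \<xi> (drop k \<gamma>) else 0)"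
    proof (rule sum.cong)
      fix \<alpha> :: "'n list" assume "\<alpha> \<in> words k"
      then have len: "length \<alpha> = k" by (simp add: words_def)
      show "a \<alpha> * Rep_ell2 (word_op (scaled_creation r) \<alpha> \<xi>) \<gamma> = (if \<alpha> = take k \<gamma>
          then complex_of_real r ^ k * a (take k \<gamma>) * Rep_ell2 \<xi> (drop k \<gamma>) else 0)"
        unfolding Rep_word_scaled_creation len by auto
    qed simp
    \<comment> \<open>For k > length \<gamma>, \<open>take k \<gamma>\<close> is \<gamma> itself and
      not a word of length k, so nothing contributes.\<close>
    also have "\<dots> = g k"
      unfolding g_def by (subst sum.delta[OF finite_words]) (auto simp: words_def)
    finally show ?thesis .
  qed
  moreover have eval: "(\<lambda>k. calculus_term (scaled_creation r) a k \<xi>) sums free_eval a (scaled_creation r) \<xi>"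
    unfolding free_eval_eq[OF lin]
    by (rule bounded_linear.sums[OF blinfun.bounded_linear_left summable_sums[OF sum]])
  ultimately have "g sums Rep_ell2 (free_eval a (scaled_creation r) \<xi>) \<gamma>"
    using bounded_linear.sums[OF bounded_linear_Rep_ell2 eval, of \<gamma>] by simp
  moreover have "g sums (\<Sum>k\<le>length \<gamma>. g k)"
    by (rule sums_finite) (simp_all add: g_def)
  ultimately have "Rep_ell2 (free_eval a (scaled_creation r) \<xi>) \<gamma> = (\<Sum>k\<le>length \<gamma>. g k)"
    by (rule sums_unique2)
  then show ?thesis by (simp add: convolution_def g_def)
qed

text \<open>A mere injection of sets suffices, since \<open>transport\<close> supplies the
  structure. Words are countable and so embed in \<open>'u\<close>. Off the range of \<iota> the
  function takes unspecified coordinate values, but injectivity is tested on the range.\<close>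

lemma inj_fock_embedding:
  obtains \<phi> :: "'n :: finite fock \<Rightarrow> 'u :: infinite \<Rightarrow> complex" where "inj \<phi>"
proof -
  have "countable (UNIV :: 'n list set)"
    using countable_lists[of "UNIV :: 'n set"] by (simp add: countable_finite)
  then have "inj (to_nat_on (UNIV :: 'n list set))" by (rule inj_on_to_nat_on)
  moreover obtain e :: "nat \<Rightarrow> 'u" where "inj e"
    using infinite_countable_subset[OF infinite_UNIV] by blast
  ultimately obtain \<iota> :: "'n list \<Rightarrow> 'u" where \<iota>: "inj \<iota>" using inj_compose by blast
  have "inj (\<lambda>\<xi> :: 'n fock. Rep_ell2 \<xi> \<circ> the_inv \<iota>)"
  proof (rule injI)
    fix \<xi> \<eta> :: "'n fock"
    assume "Rep_ell2 \<xi> \<circ> the_inv \<iota> = Rep_ell2 \<eta> \<circ> the_inv \<iota>"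
    then have "Rep_ell2 \<xi> \<alpha> = Rep_ell2 \<eta> \<alpha>" for \<alpha>
      by (metis comp_apply the_inv_f_f[OF \<iota>])
    then show "\<xi> = \<eta>" by (rule ell2_eqI)
  qed
  then show thesis by (rule that)
qed

text \<open>The coordinates of $f(rS)\xi$ are finite sums, so the bound on $f(rS)$ survives the
  limit $r \to 1$ coordinatewise.\<close>

lemma sum_convolution_le:
  fixes a :: "'n :: finite list \<Rightarrow> complex" and \<xi> :: "'n fock"
  assumes a: "a \<in> hinf TYPE('u :: infinite \<Rightarrow> complex)" and G: "finite G"
  shows "(\<Sum>\<gamma>\<in>G. (cmod (convolution a (Rep_ell2 \<xi>) \<gamma>))\<^sup>2)
    \<le> (hinf_norm TYPE('u \<Rightarrow> complex) a * norm \<xi>)\<^sup>2"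
proof -
  define N where "N = hinf_norm TYPE('u \<Rightarrow> complex) a"
  define r where "r n = real n / real (Suc n)" for n
  obtain \<phi> :: "'n fock \<Rightarrow> 'u \<Rightarrow> complex" where \<phi>: "inj \<phi>" by (rule inj_fock_embedding)
  have "(\<Sum>\<gamma>\<in>G. (cmod (convolution (\<lambda>\<alpha>. complex_of_real (r n) ^ length \<alpha> * a \<alpha>) (Rep_ell2 \<xi>) \<gamma>))\<^sup>2)
      \<le> (N * norm \<xi>)\<^sup>2" for n
  proof -
    have r: "0 \<le> r n" "r n < 1" by (simp_all add: r_def)
    have "norm (gram (scaled_creation (r n) :: 'n \<Rightarrow> _) UNIV) \<le> (r n)\<^sup>2"
      using r(1) by (rule norm_gram_scaled_creation)
    also have "\<dots> < 1" using r by (simp add: power_less_one_iff abs_square_less_1)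
    finally have contr: "norm (gram (scaled_creation (r n) :: 'n \<Rightarrow> _) UNIV) < 1" .
    have "norm (free_eval a (scaled_creation (r n))) \<le> N"
      unfolding N_def by (rule norm_free_eval_le_hinf_norm[OF \<phi> clinear_scaled_creation contr a])
    then have "norm (free_eval a (scaled_creation (r n)) \<xi>) \<le> N * norm \<xi>"
      by (meson mult_right_mono norm_blinfun norm_ge_zero order_trans)
    then have le: "(norm (free_eval a (scaled_creation (r n)) \<xi>))\<^sup>2 \<le> (N * norm \<xi>)\<^sup>2"
      by (rule power_mono) simp
    have "summable (calculus_term (scaled_creation (r n)) a)"
      using a by (intro strict_gram_summable clinear_scaled_creation contr) (simp add: hinf_def)
    from ell2_sum_le_norm_sq[OF G, of "free_eval a (scaled_creation (r n)) \<xi>",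
        unfolded Rep_free_eval_scaled_creation[OF this]] le
    show ?thesis by (rule order_trans)
  qed
  moreover have "r \<longlonglongrightarrow> 1"
    unfolding r_def by (rule LIMSEQ_n_over_Suc_n)
  then have "(\<lambda>n. \<Sum>\<gamma>\<in>G. (cmod (convolution (\<lambda>\<alpha>. complex_of_real (r n) ^ length \<alpha> * a \<alpha>) (Rep_ell2 \<xi>) \<gamma>))\<^sup>2)
      \<longlonglongrightarrow> (\<Sum>\<gamma>\<in>G. (cmod (convolution (\<lambda>\<alpha>. complex_of_real 1 ^ length \<alpha> * a \<alpha>) (Rep_ell2 \<xi>) \<gamma>))\<^sup>2)"
    unfolding convolution_def by (intro tendsto_intros)
  ultimately show ?thesis
    unfolding N_def[symmetric] by (intro LIMSEQ_le_const2) auto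
qed

section \<open>Left multiplication by f as a bounded operator\<close>

lemma convolution_add: "convolution a (\<lambda>\<gamma>. \<xi> \<gamma> + \<eta> \<gamma>) \<gamma> = convolution a \<xi> \<gamma> + convolution a \<eta> \<gamma>"
  by (simp add: convolution_def distrib_left sum.distrib)

lemma convolution_scale: "convolution a (\<lambda>\<gamma>. c * \<xi> \<gamma>) \<gamma> = c * convolution a \<xi> \<gamma>"
  by (simp add: convolution_def sum_distrib_left mult_ac)

lemma convolution_fock_basis:
  "convolution a (Rep_ell2 (fock_basis \<beta>)) (\<alpha> @ \<beta>) = a \<alpha>"
  "\<gamma> \<notin> range (\<lambda>\<alpha>. \<alpha> @ \<beta>) \<Longrightarrow> convolution a (Rep_ell2 (fock_basis \<beta>)) \<gamma> = 0"
proof -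
  have "drop m (\<alpha> @ \<beta>) = \<beta> \<longleftrightarrow> m = length \<alpha>" if "m \<le> length (\<alpha> @ \<beta>)" for m
  proof
    assume "drop m (\<alpha> @ \<beta>) = \<beta>"
    then have "length (\<alpha> @ \<beta>) - m = length \<beta>" by (metis length_drop)
    then show "m = length \<alpha>" using that by simp
  qed simp
  then have "convolution a (Rep_ell2 (fock_basis \<beta>)) (\<alpha> @ \<beta>)
      = (\<Sum>m\<le>length (\<alpha> @ \<beta>). if m = length \<alpha> then a \<alpha> else 0)"
    unfolding convolution_def by (intro sum.cong) (auto simp: fock_basis.rep_eq)
  then show "convolution a (Rep_ell2 (fock_basis \<beta>)) (\<alpha> @ \<beta>) = a \<alpha>" by simp
  assume "\<gamma> \<notin> range (\<lambda>\<alpha>. \<alpha> @ \<beta>)"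
  then have "drop m \<gamma> \<noteq> \<beta>" for m by (metis append_take_drop_id rangeI)
  then show "convolution a (Rep_ell2 (fock_basis \<beta>)) \<gamma> = 0"
    by (simp add: convolution_def fock_basis.rep_eq)
qed

text \<open>Bounds over finite sets of coordinates are what the limit of f(rS) provides. They make
  the convolution square summable, hence a vector of Fock space, and give the operator bound
  N.\<close>

lemma convolution_operator:
  fixes a :: "'n :: finite list \<Rightarrow> complex"
  assumes N: "N \<ge> 0" and le: "\<And>\<xi> :: 'n fock. \<And>G. finite G \<Longrightarrow>
    (\<Sum>\<gamma>\<in>G. (cmod (convolution a (Rep_ell2 \<xi>) \<gamma>))\<^sup>2) \<le> (N * norm \<xi>)\<^sup>2"
  obtains F :: "'n fock \<Rightarrow>\<^sub>L 'n fock"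
  where "clinear F" "\<And>\<xi> \<gamma>. Rep_ell2 (F \<xi>) \<gamma> = convolution a (Rep_ell2 \<xi>) \<gamma>"
proof -
  define F where "F \<xi> = Abs_ell2 (convolution a (Rep_ell2 \<xi>))" for \<xi> :: "'n fock"
  have "(\<lambda>\<gamma>. (cmod (convolution a (Rep_ell2 \<xi>) \<gamma>))\<^sup>2) summable_on UNIV" for \<xi>
    by (rule nonneg_bdd_above_summable_on) (auto intro!: bdd_aboveI2[OF le])
  then have Rep: "Rep_ell2 (F \<xi>) = convolution a (Rep_ell2 \<xi>)" for \<xi>
    by (simp add: F_def Abs_ell2_inverse)
  have add: "F (\<xi> + \<eta>) = F \<xi> + F \<eta>" for \<xi> \<eta>
    by (rule ell2_eqI) (simp add: Rep plus_ell2.rep_eq convolution_add)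
  have scale: "F (c *\<^sub>C \<xi>) = c *\<^sub>C F \<xi>" for c \<xi>
    by (rule ell2_eqI) (simp add: Rep scaleC_ell2.rep_eq scaleC_complex_def convolution_scale)
  have "(norm (F \<xi>))\<^sup>2 \<le> (N * norm \<xi>)\<^sup>2" for \<xi>
    unfolding ell2_norm_sq[of "F \<xi>"]
    by (rule infsum_le_finite_sums[OF Rep_ell2_summable]) (simp add: Rep le)
  then have "norm (F \<xi>) \<le> N * norm \<xi>" for \<xi>
    by (rule power2_le_imp_le) (simp add: N)
  then have "bounded_linear F"
    by (intro bounded_linear_intro[where K = N]) (simp_all add: add scale scaleR_scaleC mult.commute)
  then have "blinfun_apply (Blinfun F) = F" by (rule bounded_linear_Blinfun_apply)
  then show thesis
    using add scale Rep by (intro that[of "Blinfun F"]) (simp_all add: clinear_def)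
qed

text \<open>The expansion of F e_\<beta> is supported on the words ending in \<beta>; since
  appending \<beta> is injective, it reindexes to the series in the description.\<close>

lemma boundary_function_eqI:
  fixes F :: "'n :: finite fock \<Rightarrow>\<^sub>L 'n fock"
  assumes lin: "clinear F" and F: "\<And>\<xi> \<gamma>. Rep_ell2 (F \<xi>) \<gamma> = convolution a (Rep_ell2 \<xi>) \<gamma>"
  shows "boundary_function a = F"
  unfolding boundary_function_def
proof (rule the_equality)
  have sum: "((\<lambda>\<alpha>. a \<alpha> *\<^sub>C fock_basis (\<alpha> @ \<beta>)) has_sum F (fock_basis \<beta>)) UNIV" for \<beta>
  proof -
    have "((\<lambda>\<gamma>. Rep_ell2 (F (fock_basis \<beta>)) \<gamma> *\<^sub>C fock_basis \<gamma>) has_sum F (fock_basis \<beta>))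
        (range (\<lambda>\<alpha>. \<alpha> @ \<beta>))"
      by (rule iffD1[OF has_sum_cong_neutral fock_expansion])
        (auto simp: F convolution_fock_basis(2))
    then show ?thesis
      by (subst (asm) has_sum_reindex) (auto simp: inj_def o_def F convolution_fock_basis(1))
  qed
  then show "clinear F \<and> (\<forall>\<beta>. ((\<lambda>\<alpha>. a \<alpha> *\<^sub>C fock_basis (\<alpha> @ \<beta>)) has_sum F (fock_basis \<beta>)) UNIV)"
    using lin by blast
  fix E :: "'n fock \<Rightarrow>\<^sub>L 'n fock"
  assume E: "clinear E \<and> (\<forall>\<beta>. ((\<lambda>\<alpha>. a \<alpha> *\<^sub>C fock_basis (\<alpha> @ \<beta>)) has_sum E (fock_basis \<beta>)) UNIV)"
  then have "E (fock_basis \<beta>) = F (fock_basis \<beta>)" for \<beta>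
    using sum[of \<beta>] has_sum_unique by blast
  then show "E = F"
    using E lin by (intro clinear_fock_tensor_eqI) (simp add: tensor_complex clinear_scaleC)
qed

theorem theorem4p3:
  fixes T :: "'n :: finite \<Rightarrow> 'h :: chilbert_space \<Rightarrow>\<^sub>L 'h"
    and a :: "'n list \<Rightarrow> complex"
  assumes "\<And>i. clinear (T i)"
    and "joint_spectral_radius T < 1"
    and "a \<in> hinf TYPE('u :: infinite \<Rightarrow> complex)"
  shows "free_eval a T = cauchy_transform T (boundary_function a) \<and>
    norm (free_eval a T) \<le>
      (\<Sum>k. sqrt (norm (\<Sum>\<alpha>\<in>words k. word_op T \<alpha> o\<^sub>L cadjoint (word_op T \<alpha>))))
        * hinf_norm TYPE('u \<Rightarrow> complex) a"
proof -
  define N where "N = hinf_norm TYPE('u \<Rightarrow> complex) a"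
  obtain \<phi> :: "'n fock \<Rightarrow> 'u \<Rightarrow> complex" where \<phi>: "inj \<phi>" by (rule inj_fock_embedding)
  \<comment> \<open>The tuple with r = 0 only serves to show N nonnegative: N dominates the norm of
    f there, whereas a real supremum has no sign by itself.\<close>
  have "norm (gram (scaled_creation 0 :: 'n \<Rightarrow> _) UNIV) < 1"
    using norm_gram_scaled_creation[of 0, where 'n = 'n] by simp
  from norm_free_eval_le_hinf_norm[OF \<phi> clinear_scaled_creation this assms(3)]
  have N: "N \<ge> 0" unfolding N_def by (rule order_trans[OF norm_ge_zero])
  note le = sum_convolution_le[OF assms(3), folded N_def]
  obtain F :: "'n fock \<Rightarrow>\<^sub>L 'n fock"
    where F: "clinear F" "\<And>\<xi> \<gamma>. Rep_ell2 (F \<xi>) \<gamma> = convolution a (Rep_ell2 \<xi>) \<gamma>"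
    using convolution_operator[OF N le] by blast
  have coeff: "convolution a (Rep_ell2 (fock_basis [])) \<alpha> = a \<alpha>" for \<alpha>
    using convolution_fock_basis(1)[of a "[]" \<alpha>] by simp
  \<comment> \<open>On the vacuum vector the convolution has coordinates \<open>a \<alpha>\<close>;
    restricting its norm bound to the words of length k gives the coefficient estimate.\<close>
  have bound: "(\<Sum>\<alpha>\<in>words k. (cmod (a \<alpha>))\<^sup>2) \<le> N\<^sup>2" for k
    using le[of "words k" "fock_basis []"] by (simp add: coeff)
  show ?thesis
    using cauchy_transform_eq_free_eval[OF assms(1,2) N bound F(1), unfolded F(2), OF coeff]
      norm_free_eval_le[OF assms(1,2) N bound] boundary_function_eqI[OF F]
    by (simp add: N_def gram_def)
qed

end
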